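(* Let $U\not\subseteq\mathbb O(d)$ be a closed subgroup of $\mathbb S(d)$, $\alpha>0$, and let $\bar\nu$ be a Lévy measure on $\mathbb R^d\setminus\{0\}$. The following are equivalent: (i) $\bar\nu(gB)=\|g\|^{-\alpha}\bar\nu(B)$ for all $g\in U$ and all Borel $B\subseteq\mathbb R^d\setminus\{0\}$; (ii) there is a $C_U$-invariant finite measure $\rho$ on $S_U$ such that for all $\bar\nu$-integrable $f:\mathbb R^d\setminus\{0\}\to\mathbb R$, $$\int f(x)\,\bar\nu(dx)=\int_{A_U}\int_{S_U}f(ax)\|a\|^{-\alpha}\rho(dx)\,H_{A_U}(da).$$
   Context: $\mathbb S(d)$: group of similarity matrices $to$ ($t>0$, $o\in\mathbb O(d)$), $\|\cdot\|$ operator norm. Structure (known): with $C_U=U\cap\mathbb O(d)$ and $G=\{\|u\|:u\in U\}$, either $G=r^{\mathbb Z}$ for some $0<r<1$ (discrete case) or $G=(0,\infty)$ (continuous case); there is a closed subgroup $A_U\subseteq U$ isomorphic to $G$ with $U=A_U\ltimes C_U$, where $A_U=\{A^n:n\in\mathbb Z\}$ with $\|A\|=r$ in the discrete case and $A_U=\{t^Q:t>0\}$, $t^Q=e^{(\ln t)Q}$, with $Q$ commuting with $C_U$ in the continuous case. $S_U=\mathbb S^{d-1}$ in the continuous case and $S_U=\{x:r\le|x|<1\}$ in the discrete case. $\rho$ is $C_U$-invariant if $\rho(oB)=\rho(B)$ for all $o\in C_U$. $H_{A_U}$ is Haar measure on $A_U$, normalized as counting measure in the discrete case and such that its image under $a\mapsto\|a\|$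 is $dt/t$ in the continuous case. *)

theory Defs
  imports "HOL-Analysis.Analysis"
begin

text \<open>Operator norm of a square matrix acting on Euclidean space.\<close>
definition opnorm :: "real^'n^'n \<Rightarrow> real" where
  "opnorm M = onorm (\<lambda>x. M *v x)"

text \<open>The similarity group S(d): matrices t o with t > 0 and o orthogonal.\<close>
definition similarity_matrices :: "(real^'n^'n) set" where
  "similarity_matrices = {t *\<^sub>R M | t M. t > 0 \<and> orthogonal_matrix M}"

definition orthogonal_matrices :: "(real^'n^'n) set" where
  "orthogonal_matrices = {M. orthogonal_matrix M}"

text \<open>Subgroup of the general linear group (contains identity, closed under
  products and inverses).\<close>
definition matrix_subgroup :: "(real^'n^'n) set \<Rightarrow> bool" where
  "matrix_subgroup U \<longleftrightarrow> mat 1 \<in> U \<and> (\<forall>a\<in>U. \<forall>b\<in>U. a ** b \<in> U)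
      \<and> (\<forall>a\<in>U. invertible a \<and> matrix_inv a \<in> U)"

text \<open>Natural and integer matrix powers.\<close>
primrec matpow :: "real^'n^'n \<Rightarrow> nat \<Rightarrow> real^'n^'n" where
  "matpow A 0 = mat 1"
| "matpow A (Suc k) = A ** matpow A k"

definition matpowi :: "real^'n^'n \<Rightarrow> int \<Rightarrow> real^'n^'n" where
  "matpowi A n = (if n \<ge> 0 then matpow A (nat n) else matpow (matrix_inv A) (nat (- n)))"

text \<open>Matrix exponential e^M and t^Q = e^{(ln t) Q}.\<close>
definition matexp :: "real^'n^'n \<Rightarrow> real^'n^'n" where
  "matexp M = (\<Sum>k. (1 / fact k) *\<^sub>R matpow M k)"

definition matrpow :: "real \<Rightarrow> real^'n^'n \<Rightarrow> real^'n^'n" where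
  "matrpow t Q = matexp (ln t *\<^sub>R Q)"

text \<open>C_U = U \<inter> O(d) and G = {\<parallel>u\<parallel> : u \<in> U}.\<close>
definition CU :: "(real^'n^'n) set \<Rightarrow> (real^'n^'n) set" where
  "CU U = U \<inter> orthogonal_matrices"

definition GU :: "(real^'n^'n) set \<Rightarrow> real set" where
  "GU U = opnorm ` U"

text \<open>Levy measure on R^d \ {0}, encoded as a Borel measure on R^d with no mass at 0.\<close>
definition levy_measure :: "(real^'n) measure \<Rightarrow> bool" where
  "levy_measure M \<longleftrightarrow> sets M = sets borel \<and> emeasure M {0} = 0 \<and>
     (\<integral>\<^sup>+ x. ennreal (min 1 (norm x ^ 2)) \<partial>M) < \<infinity>"

text \<open>Haar measure on A_U in the continuous case: image of dt/t on (0,\<infinity>)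
  under the inverse of a \<mapsto> \<parallel>a\<parallel> on A_U.\<close>
definition haar_cont :: "(real^'n^'n) set \<Rightarrow> (real^'n^'n) measure" where
  "haar_cont AU = distr (density (restrict_space lborel {0<..}) (\<lambda>t. ennreal (1 / t)))
      borel (\<lambda>t. THE a. a \<in> AU \<and> opnorm a = t)"

end

theory Submission
  imports Defs
begin

text \<open>Both sides of the equivalence are polar coordinates along the scaling group \<open>A\<^sub>U\<close>.
  Fix a kernel \<open>k\<close> on \<open>(0,\<infinity>)\<close> whose dilates all have Haar mass one,
  \<open>\<integral> k(\<bar>z\<bar>/\<parallel>b\<parallel>) H(db) = 1\<close>, and a measurable choice \<open>\<Psi>(t) \<in> A\<^sub>U\<close> commuting with \<open>C\<^sub>U\<close>
  that moves the sphere of radius \<open>t\<close> into \<open>S\<^sub>U\<close>. For a scale-invariant \<open>\<nu>\<close>, let \<open>\<rho>\<close> be the image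
  of \<open>k(\<bar>y\<bar>) \<parallel>\<Psi>(\<bar>y\<bar>)\<parallel>^(-\<alpha>) \<nu>(dy)\<close> under \<open>y \<mapsto> \<Psi>(\<bar>y\<bar>) y\<close>; left invariance of \<open>H\<close>, the
  scaling of \<open>\<nu>\<close> and Tonelli turn the polar integral back into \<open>\<integral> f d\<nu>\<close>. Conversely, the polar
  formula with \<open>C\<^sub>U\<close>-invariance of \<open>\<rho>\<close> and invariance of \<open>H\<close> yields the scaling on sets of finite
  \<open>\<nu>\<close>-measure bounded away from \<open>0\<close>, and these exhaust every Borel set avoiding \<open>0\<close>.
  In the discrete case \<open>k\<close> is the indicator of \<open>[r,1)\<close> and \<open>\<Psi> = 1\<close>; in the continuous case
  \<open>k\<close> is the indicator of \<open>[1,e]\<close> and \<open>\<Psi>(t)\<close> is the element of \<open>A\<^sub>U\<close> of norm \<open>1/t\<close>.\<close>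

section \<open>Similarity matrices\<close>

lemma matrix_mul_matrix_inv:
  fixes A :: "real^'n^'n"
  assumes "invertible A"
  shows "A ** matrix_inv A = mat 1" and "matrix_inv A ** A = mat 1"
proof -
  have "\<exists>A'. A ** A' = mat 1 \<and> A' ** A = mat 1" using assms unfolding invertible_def by blast
  hence "A ** matrix_inv A = mat 1 \<and> matrix_inv A ** A = mat 1"
    unfolding matrix_inv_def by (rule someI_ex)
  thus "A ** matrix_inv A = mat 1" "matrix_inv A ** A = mat 1" by auto
qed

lemma norm_orthogonal_matrix_vector:
  "orthogonal_matrix (M::real^'n^'n) \<Longrightarrow> norm (M *v x) = norm x"
  by (metis (no_types, lifting) dot_matrix_vector_mul matrix_vector_mul_lid
    norm_eq orthogonal_matrix_def orthogonal_matrix_id)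

lemma opnorm_eqI:
  fixes M :: "real^'n^'n"
  assumes "\<And>x. norm (M *v x) = c * norm x"
  shows "opnorm M = c"
proof -
  let ?e = "axis undefined 1 :: real^'n"
  have "opnorm M \<le> c" unfolding opnorm_def by (rule onorm_le) (simp add: assms)
  moreover have "norm (M *v ?e) \<le> opnorm M * norm ?e"
    unfolding opnorm_def by (rule onorm[OF matrix_vector_mul_bounded_linear])
  ultimately show ?thesis using assms[of ?e] by (simp add: norm_axis_1)
qed

lemma opnorm_orthogonal_matrix: "orthogonal_matrix (M::real^'n^'n) \<Longrightarrow> opnorm M = 1"
  by (rule opnorm_eqI) (simp add: norm_orthogonal_matrix_vector)

lemma opnorm_mat_1: "opnorm (mat 1 :: real^'n^'n) = 1"
  by (rule opnorm_orthogonal_matrix[OF orthogonal_matrix_id])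

lemma similarity_matrixE:
  fixes g :: "real^'n^'n"
  assumes "g \<in> similarity_matrices"
  obtains M where "orthogonal_matrix M" "g = opnorm g *\<^sub>R M" "opnorm g > 0"
    "\<And>x. norm (g *v x) = opnorm g * norm x"
proof -
  obtain t M where g: "g = t *\<^sub>R M" "t > 0" "orthogonal_matrix M"
    using assms unfolding similarity_matrices_def by blast
  have n: "\<And>x. norm (g *v x) = t * norm x"
    using g by (simp add: scaleR_matrix_vector_assoc[symmetric] norm_orthogonal_matrix_vector)
  with g opnorm_eqI[OF n] that show ?thesis by auto
qed

lemma norm_similarity_matrix_vector:
  "g \<in> similarity_matrices \<Longrightarrow> norm (g *v x) = opnorm g * norm x"
  by (erule similarity_matrixE) auto

lemma opnorm_similarity_pos: "g \<in> similarity_matrices \<Longrightarrow> opnorm g > 0"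
  by (erule similarity_matrixE) auto

lemma similarity_orthogonal_iff_opnorm:
  "g \<in> similarity_matrices \<Longrightarrow> orthogonal_matrix g \<longleftrightarrow> opnorm g = 1"
  by (metis similarity_matrixE opnorm_orthogonal_matrix scaleR_one)

lemma opnorm_add_le: "opnorm ((X::real^'n^'n) + Y) \<le> opnorm X + opnorm Y"
proof -
  have "(\<lambda>x. X *v x + Y *v x) = (*v) (X + Y)"
    by (rule ext) (simp add: matrix_vector_mult_add_rdistrib)
  moreover have "onorm (\<lambda>x. X *v x + Y *v x) \<le> onorm ((*v) X) + onorm ((*v) Y)"
    by (rule onorm_triangle) (rule matrix_vector_mul_bounded_linear)+
  ultimately show ?thesis unfolding opnorm_def by simp
qed

lemma opnorm_matrix_mul_le: "opnorm ((X::real^'n^'n) ** Y) \<le> opnorm X * opnorm Y"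
proof -
  have "(*v) X \<circ> (*v) Y = (*v) (X ** Y)" by (rule ext) (simp add: matrix_vector_mul_assoc)
  moreover have "onorm ((*v) X \<circ> (*v) Y) \<le> onorm ((*v) X) * onorm ((*v) Y)"
    by (rule onorm_compose) (rule matrix_vector_mul_bounded_linear)+
  ultimately show ?thesis unfolding opnorm_def by simp
qed

lemma opnorm_le_norm: "opnorm (M::real^'n^'n) \<le> real CARD('n) * real CARD('n) * norm M"
  unfolding opnorm_def
proof (rule onorm_le_matrix_component)
  fix i j
  have "\<bar>M $ i $ j\<bar> \<le> norm (M $ i)" by (rule component_le_norm_cart)
  also have "\<dots> \<le> norm M" by (simp add: Finite_Cartesian_Product.norm_nth_le)
  finally show "\<bar>M $ i $ j\<bar> \<le> norm M" .
qed

lemma norm_le_opnorm: "norm (X::real^'n^'n) \<le> real CARD('n) * real CARD('n) * opnorm X"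
proof -
  have c: "\<bar>X $ i $ j\<bar> \<le> opnorm X" for i j
    using component_le_onorm[of "(*v) X" i j] unfolding opnorm_def
    by (simp add: matrix_of_matrix_vector_mul matrix_vector_mul_linear)
  have "norm X \<le> (\<Sum>i\<in>UNIV. norm (X $ i))" unfolding norm_vec_def by (rule L2_set_le_sum) simp
  also have "\<dots> \<le> (\<Sum>i\<in>(UNIV::'n set). \<Sum>j\<in>(UNIV::'n set). \<bar>X $ i $ j\<bar>)"
    by (rule sum_mono) (rule norm_le_l1_cart[of "X $ _", simplified])
  also have "\<dots> \<le> (\<Sum>i\<in>(UNIV::'n set). \<Sum>j\<in>(UNIV::'n set). opnorm X)"
    by (intro sum_mono c)
  also have "\<dots> = real CARD('n) * real CARD('n) * opnorm X" by simp
  finally show ?thesis .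
qed

lemma continuous_on_opnorm: "continuous_on UNIV (opnorm :: real^'n^'n \<Rightarrow> real)"
proof (rule lipschitz_on_continuous_on)
  have "\<bar>opnorm A - opnorm B\<bar> \<le> real CARD('n) * real CARD('n) * norm (A - B)"
    for A B :: "real^'n^'n"
    using opnorm_add_le[of "A - B" B] opnorm_add_le[of "B - A" A]
      opnorm_le_norm[of "A - B"] opnorm_le_norm[of "B - A"]
    by (simp add: abs_le_iff norm_minus_commute)
  then show "(real CARD('n) * real CARD('n))-lipschitz_on UNIV (opnorm :: real^'n^'n \<Rightarrow> real)"
    by (intro lipschitz_onI) (auto simp: dist_norm)
qed

lemma borel_measurable_opnorm [measurable]: "(opnorm :: real^'n^'n \<Rightarrow> real) \<in> borel_measurable borel"
  using continuous_on_opnorm by (rule borel_measurable_continuous_onI)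

lemma borel_measurable_matrix_vector_mult_pair [measurable]:
  "(\<lambda>p::(real^'n^'m) \<times> (real^'n). fst p *v snd p) \<in> borel_measurable borel"
proof (rule borel_measurable_continuous_onI)
  show "continuous_on UNIV (\<lambda>p::(real^'n^'m) \<times> (real^'n). fst p *v snd p)"
    unfolding matrix_vector_mult_def by (intro continuous_on_vec_lambda continuous_intros)
qed

lemma borel_measurable_matrix_vector_mult [measurable]:
  "((*v) (a::real^'n^'m)) \<in> borel_measurable borel"
  by (rule borel_measurable_continuous_onI) (rule matrix_vector_mult_linear_continuous_on)

lemma borel_measurable_matrix_mult_left [measurable]:
  "((**) (a::real^'n^'m)) \<in> borel_measurable (borel :: (real^'k^'n) measure)"
proof (rule borel_measurable_continuous_onI)
  show "continuous_on UNIV ((**) a :: real^'k^'n \<Rightarrow> real^'k^'m)"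
    unfolding matrix_matrix_mult_def by (intro continuous_on_vec_lambda continuous_intros)
qed

lemma borel_measurable_norm_dependent_matrix_apply:
  assumes "(P :: real \<Rightarrow> real^'n^'n) \<in> borel_measurable borel"
  shows "(\<lambda>y::real^'n. P (norm y) *v y) \<in> borel_measurable borel"
proof -
  have "(\<lambda>y::real^'n. (P (norm y), y)) \<in> measurable borel (borel \<Otimes>\<^sub>M borel)"
    using assms by measurable
  hence "(\<lambda>y::real^'n. (P (norm y), y)) \<in> measurable borel borel" by (simp add: borel_prod)
  from measurable_compose[OF this borel_measurable_matrix_vector_mult_pair] show ?thesis by simp
qed

locale similarity_subgroup =
  fixes U :: "(real^'n^'n) set"
  assumes subgroup: "matrix_subgroup U" and similarity: "U \<subseteq> similarity_matrices"
begin

lemma mult_closed: "a \<in> U \<Longrightarrow> b \<in> U \<Longrightarrow> a ** b \<in> U"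
  and inv_closed: "a \<in> U \<Longrightarrow> matrix_inv a \<in> U"
  and invertible: "a \<in> U \<Longrightarrow> invertible a"
  using subgroup unfolding matrix_subgroup_def by blast+

lemma mult_inv_right: "a \<in> U \<Longrightarrow> a ** matrix_inv a = mat 1"
  and mult_inv_left: "a \<in> U \<Longrightarrow> matrix_inv a ** a = mat 1"
  using matrix_mul_matrix_inv invertible by blast+

lemma inv_apply_cancel: "a \<in> U \<Longrightarrow> matrix_inv a *v (a *v x) = x"
  and apply_inv_cancel: "a \<in> U \<Longrightarrow> a *v (matrix_inv a *v x) = x"
  by (simp_all add: matrix_vector_mul_assoc mult_inv_left mult_inv_right)

lemma inj_apply: "a \<in> U \<Longrightarrow> inj (\<lambda>x. a *v x)"
  by (rule injI) (metis inv_apply_cancel)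

lemma norm_apply: "a \<in> U \<Longrightarrow> norm (a *v x) = opnorm a * norm x"
  and opnorm_pos: "a \<in> U \<Longrightarrow> opnorm a > 0"
  and orthogonal_iff_opnorm: "a \<in> U \<Longrightarrow> orthogonal_matrix a \<longleftrightarrow> opnorm a = 1"
  using similarity norm_similarity_matrix_vector opnorm_similarity_pos
    similarity_orthogonal_iff_opnorm by blast+

lemma opnorm_mult: "a \<in> U \<Longrightarrow> b \<in> U \<Longrightarrow> opnorm (a ** b) = opnorm a * opnorm b"
  by (rule opnorm_eqI) (simp add: matrix_vector_mul_assoc[symmetric] norm_apply)

lemma opnorm_inv:
  assumes a: "a \<in> U"
  shows "opnorm (matrix_inv a) = 1 / opnorm a"
proof -
  have "opnorm a * opnorm (matrix_inv a) = 1"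
    using opnorm_mult[OF a inv_closed[OF a]] mult_inv_right[OF a] opnorm_mat_1 by metis
  thus ?thesis using opnorm_pos[OF a] by (simp add: field_simps)
qed

lemma image_eq_vimage_inv: "a \<in> U \<Longrightarrow> (\<lambda>x. a *v x) ` B = (\<lambda>x. matrix_inv a *v x) -` B"
  by (auto simp: inv_apply_cancel) (metis apply_inv_cancel image_eqI)

lemma vimage_eq_image_inv: "a \<in> U \<Longrightarrow> (\<lambda>x. a *v x) -` B = (\<lambda>x. matrix_inv a *v x) ` B"
  by (auto simp: apply_inv_cancel) (metis inv_apply_cancel image_eqI)

lemma image_in_borel: "a \<in> U \<Longrightarrow> B \<in> sets borel \<Longrightarrow> (\<lambda>x. a *v x) ` B \<in> sets borel"
  using measurable_sets[OF borel_measurable_matrix_vector_mult, of B "matrix_inv a"]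
  by (simp add: image_eq_vimage_inv)

end

locale polar_decomposition = similarity_subgroup U for U :: "(real^'n^'n) set" +
  fixes AU :: "(real^'n^'n) set"
  assumes AU_subgroup: "matrix_subgroup AU" and AU_sub: "AU \<subseteq> U"
    and semidirect: "\<forall>u\<in>U. \<exists>a\<in>AU. \<exists>c\<in>CU U. u = a ** c"
    and AU_CU: "AU \<inter> CU U = {mat 1}"
begin

lemma AU_one: "mat 1 \<in> AU"
  and AU_mult_closed: "a \<in> AU \<Longrightarrow> b \<in> AU \<Longrightarrow> a ** b \<in> AU"
  and AU_inv_closed: "a \<in> AU \<Longrightarrow> matrix_inv a \<in> AU"
  using AU_subgroup unfolding matrix_subgroup_def by blast+

lemma AU_in_U: "a \<in> AU \<Longrightarrow> a \<in> U"
  using AU_sub by blast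

lemma CU_iff: "c \<in> CU U \<longleftrightarrow> c \<in> U \<and> opnorm c = 1"
  using orthogonal_iff_opnorm unfolding CU_def orthogonal_matrices_def by blast

lemma CU_inv_closed: "c \<in> CU U \<Longrightarrow> matrix_inv c \<in> CU U"
  using CU_iff inv_closed opnorm_inv by auto

lemma CU_conj_closed:
  assumes a: "a \<in> U" and c: "c \<in> CU U"
  shows "matrix_inv a ** c ** a \<in> CU U"
proof -
  have cU: "c \<in> U" "opnorm c = 1" using c CU_iff by auto
  have "opnorm (matrix_inv a ** c ** a) = opnorm (matrix_inv a) * opnorm c * opnorm a"
    using opnorm_mult mult_closed inv_closed a cU by metis
  also have "\<dots> = 1" using opnorm_inv[OF a] opnorm_pos[OF a] cU by simp
  finally show ?thesis using mult_closed inv_closed a cU CU_iff by metis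
qed

lemma AU_opnorm_inj:
  assumes "a \<in> AU" "b \<in> AU" "opnorm a = opnorm b"
  shows "a = b"
proof -
  let ?c = "matrix_inv a ** b"
  have cA: "?c \<in> AU" using AU_inv_closed AU_mult_closed assms by blast
  have aU: "a \<in> U" "b \<in> U" using AU_in_U assms by auto
  have "opnorm ?c = 1"
    using opnorm_mult[OF inv_closed[OF aU(1)] aU(2)] opnorm_inv[OF aU(1)] opnorm_pos[OF aU(1)] assms(3)
    by simp
  hence "?c = mat 1" using CU_iff cA AU_in_U AU_CU by blast
  hence "a ** ?c = a" by (simp add: matrix_mul_rid)
  thus ?thesis by (simp add: matrix_mul_assoc mult_inv_right AU_in_U assms(1) matrix_mul_lid)
qed

lemma AU_commute: "a \<in> AU \<Longrightarrow> b \<in> AU \<Longrightarrow> a ** b = b ** a"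
  by (rule AU_opnorm_inj) (auto simp: AU_mult_closed opnorm_mult AU_in_U)

lemma U_decompE:
  assumes "g \<in> U"
  obtains a c where "a \<in> AU" "c \<in> CU U" "g = a ** c" "opnorm g = opnorm a"
proof -
  obtain a c where ac: "a \<in> AU" "c \<in> CU U" "g = a ** c" using semidirect assms by blast
  with opnorm_mult[of a c] CU_iff AU_in_U that show ?thesis by auto
qed

lemma GU_AUE:
  assumes "t \<in> GU U"
  obtains a where "a \<in> AU" "opnorm a = t"
  using assms U_decompE unfolding GU_def by (metis imageE)

lemma opnorm_AU_in_GU: "a \<in> AU \<Longrightarrow> opnorm a \<in> GU U"
  unfolding GU_def using AU_in_U by blast

end

section \<open>Levy measures and the two sides of the equivalence\<close>

lemma incseq_annuli: "incseq (\<lambda>k. B \<inter> {y::'a::real_normed_vector. 1 / real (Suc k) \<le> norm y})"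
proof (rule incseq_SucI)
  fix k
  have "1 / real (Suc (Suc k)) \<le> 1 / real (Suc k)" by (simp add: frac_le)
  thus "B \<inter> {y. 1 / real (Suc k) \<le> norm y} \<subseteq> B \<inter> {y. 1 / real (Suc (Suc k)) \<le> norm y}"
    by auto
qed

lemma Union_annuli:
  assumes "0 \<notin> B"
  shows "(\<Union>k. B \<inter> {y::'a::real_normed_vector. 1 / real (Suc k) \<le> norm y}) = B"
proof -
  have "\<exists>k. 1 / real (Suc k) \<le> norm y" if "y \<in> B" for y
  proof -
    have "norm y > 0" using that assms by (cases "y = 0") auto
    then obtain k where "inverse (real (Suc k)) < norm y" using reals_Archimedean by blast
    thus ?thesis by (auto simp: field_simps intro!: exI[of _ k])
  qed
  thus ?thesis by blast
qed

lemma levy_measure_sets: "levy_measure \<nu> \<Longrightarrow> sets \<nu> = sets borel"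
  and levy_measure_zero: "levy_measure \<nu> \<Longrightarrow> emeasure \<nu> {0} = 0"
  unfolding levy_measure_def by simp_all

lemma levy_measure_outside_ball_finite:
  fixes \<nu> :: "(real^'n) measure"
  assumes L: "levy_measure \<nu>" and d: "\<delta> > 0"
  shows "emeasure \<nu> {y. \<delta> \<le> norm y} < \<infinity>"
proof -
  define m where "m = min 1 (\<delta>^2)"
  have m0: "m > 0" using d unfolding m_def by simp
  have "{y::real^'n. \<delta> \<le> norm y} \<in> sets \<nu>" using levy_measure_sets[OF L] by measurable
  hence "ennreal m * emeasure \<nu> {y. \<delta> \<le> norm y} = (\<integral>\<^sup>+y. ennreal m * indicator {y. \<delta> \<le> norm y} y \<partial>\<nu>)"
    by (simp add: nn_integral_cmult_indicator)
  also have "\<dots> \<le> (\<integral>\<^sup>+y. ennreal (min 1 (norm y ^ 2)) \<partial>\<nu>)"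
  proof (rule nn_integral_mono)
    fix y :: "real^'n"
    show "ennreal m * indicator {y. \<delta> \<le> norm y} y \<le> ennreal (min 1 (norm y ^ 2))"
    proof (cases "\<delta> \<le> norm y")
      case True
      hence "\<delta>^2 \<le> norm y ^ 2" using d by (intro power_mono) auto
      hence "m \<le> min 1 (norm y ^ 2)" unfolding m_def by auto
      thus ?thesis using True by simp
    qed simp
  qed
  also have "\<dots> < \<infinity>" using L unfolding levy_measure_def by simp
  finally show ?thesis using m0 by (auto simp: ennreal_mult_less_top)
qed

lemma levy_measure_sigma_finite:
  fixes \<nu> :: "(real^'n) measure"
  assumes L: "levy_measure \<nu>"
  shows "sigma_finite_measure \<nu>"
proof -
  define A where "A = insert {0} (range (\<lambda>k::nat. {y::real^'n. 1 / real (Suc k) \<le> norm y}))"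
  have sp: "space \<nu> = UNIV" using sets_eq_imp_space_eq[OF levy_measure_sets[OF L]] by simp
  show ?thesis
  proof (unfold_locales, intro exI[of _ A] conjI ballI)
    show "countable A" unfolding A_def by simp
    show "A \<subseteq> sets \<nu>" unfolding A_def levy_measure_sets[OF L] by auto
    have "y \<in> \<Union> A" for y
    proof (cases "y = 0")
      case False
      hence "y \<in> (\<Union>k. (UNIV - {0}) \<inter> {y::real^'n. 1 / real (Suc k) \<le> norm y})"
        using Union_annuli[of "UNIV - {0}"] by blast
      thus ?thesis unfolding A_def by blast
    qed (simp add: A_def)
    thus "\<Union> A = space \<nu>" unfolding sp by blast
  next
    fix a assume "a \<in> A"
    then consider "a = {0}" | k where "a = {y. 1 / real (Suc k) \<le> norm y}"
      unfolding A_def by blast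
    thus "emeasure \<nu> a \<noteq> \<infinity>"
    proof cases
      case 1 thus ?thesis using levy_measure_zero[OF L] by simp
    next
      case (2 k)
      have "emeasure \<nu> a < \<infinity>" unfolding 2 by (rule levy_measure_outside_ball_finite[OF L]) simp
      thus ?thesis by simp
    qed
  qed
qed

definition scale_invariant :: "(real^'n^'n) set \<Rightarrow> real \<Rightarrow> (real^'n) measure \<Rightarrow> bool" where
  "scale_invariant U \<alpha> \<nu> \<longleftrightarrow> (\<forall>g\<in>U. \<forall>B\<in>sets borel. 0 \<notin> B \<longrightarrow>
     emeasure \<nu> ((\<lambda>x. g *v x) ` B) = ennreal (opnorm g powr (- \<alpha>)) * emeasure \<nu> B)"

definition CU_invariant :: "(real^'n^'n) set \<Rightarrow> (real^'n) measure \<Rightarrow> bool" where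
  "CU_invariant U \<rho> \<longleftrightarrow> (\<forall>c\<in>CU U. \<forall>B\<in>sets borel. emeasure \<rho> ((\<lambda>x. c *v x) ` B) = emeasure \<rho> B)"

definition polar_integral ::
    "real \<Rightarrow> (real^'n^'n) measure \<Rightarrow> (real^'n) measure \<Rightarrow> (real^'n \<Rightarrow> real) \<Rightarrow> real" where
  "polar_integral \<alpha> H \<rho> f = (\<integral>a. (\<integral>x. f (a *v x) * opnorm a powr (- \<alpha>) \<partial>\<rho>) \<partial>H)"

definition polar_formula ::
    "real \<Rightarrow> (real^'n^'n) measure \<Rightarrow> (real^'n) measure \<Rightarrow> (real^'n) measure \<Rightarrow> bool" where
  "polar_formula \<alpha> H \<rho> \<nu> \<longleftrightarrow>
     (\<forall>f::real^'n \<Rightarrow> real. integrable \<nu> f \<longrightarrow> (\<integral>x. f x \<partial>\<nu>) = polar_integral \<alpha> H \<rho> f)"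

definition polar_representation :: "(real^'n^'n) set \<Rightarrow> real \<Rightarrow> (real^'n) set \<Rightarrow>
    (real^'n^'n) measure \<Rightarrow> (real^'n) measure \<Rightarrow> bool" where
  "polar_representation U \<alpha> S H \<nu> \<longleftrightarrow> (\<exists>\<rho>. sets \<rho> = sets borel \<and> finite_measure \<rho>
     \<and> emeasure \<rho> (UNIV - S) = 0 \<and> CU_invariant U \<rho> \<and> polar_formula \<alpha> H \<rho> \<nu>)"

lemma scale_invariantD:
  "scale_invariant U \<alpha> \<nu> \<Longrightarrow> g \<in> U \<Longrightarrow> B \<in> sets borel \<Longrightarrow> 0 \<notin> B \<Longrightarrow>
    emeasure \<nu> ((\<lambda>x. g *v x) ` B) = ennreal (opnorm g powr (- \<alpha>)) * emeasure \<nu> B"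
  unfolding scale_invariant_def by blast

lemma CU_invariantD:
  "CU_invariant U \<rho> \<Longrightarrow> c \<in> CU U \<Longrightarrow> B \<in> sets borel \<Longrightarrow>
    emeasure \<rho> ((\<lambda>x. c *v x) ` B) = emeasure \<rho> B"
  unfolding CU_invariant_def by blast

lemma polar_formulaD:
  "polar_formula \<alpha> H \<rho> \<nu> \<Longrightarrow> integrable \<nu> f \<Longrightarrow> (\<integral>x. f x \<partial>\<nu>) = polar_integral \<alpha> H \<rho> f"
  unfolding polar_formula_def by blast

context similarity_subgroup
begin

lemma levy_measure_image_outside_ball_finite:
  fixes \<nu> :: "(real^'n) measure"
  assumes L: "levy_measure \<nu>" and g: "g \<in> U" and \<delta>: "\<delta> > 0" and X: "X \<subseteq> {y. \<delta> \<le> norm y}"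
  shows "emeasure \<nu> ((\<lambda>x. g *v x) ` X) < \<infinity>"
proof -
  have "(\<lambda>x. g *v x) ` X \<subseteq> {y. opnorm g * \<delta> \<le> norm y}"
    using X opnorm_pos[OF g] by (auto simp: norm_apply[OF g] intro: mult_left_mono)
  hence "emeasure \<nu> ((\<lambda>x. g *v x) ` X) \<le> emeasure \<nu> {y. opnorm g * \<delta> \<le> norm y}"
    by (intro emeasure_mono) (auto simp: levy_measure_sets[OF L])
  also have "\<dots> < \<infinity>"
    by (rule levy_measure_outside_ball_finite[OF L]) (use opnorm_pos[OF g] \<delta> in simp)
  finally show ?thesis .
qed

lemma distr_scale_invariant:
  fixes \<nu> :: "(real^'n) measure"
  assumes nu_sets: "sets \<nu> = sets borel" and nu_zero: "emeasure \<nu> {0} = 0"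
    and inv: "scale_invariant U \<alpha> \<nu>" and g: "g \<in> U"
  shows "distr \<nu> borel (\<lambda>x. g *v x) = density \<nu> (\<lambda>_. ennreal (opnorm g powr \<alpha>))"
proof (rule measure_eqI)
  show "sets (distr \<nu> borel ((*v) g)) = sets (density \<nu> (\<lambda>_. ennreal (opnorm g powr \<alpha>)))"
    using nu_sets by simp
  fix X assume "X \<in> sets (distr \<nu> borel ((*v) g))"
  hence X: "X \<in> sets borel" by simp
  have sp: "space \<nu> = UNIV" using sets_eq_imp_space_eq[OF nu_sets] by simp
  have null: "{0} \<in> null_sets \<nu>" using nu_zero nu_sets by (auto intro: null_setsI)
  have mn: "measurable \<nu> = measurable borel"
    by (rule ext, rule measurable_cong_sets[OF nu_sets refl])
  have m: "(\<lambda>x. g *v x) \<in> measurable \<nu> borel"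
    unfolding mn by (rule borel_measurable_matrix_vector_mult)
  have gi: "matrix_inv g \<in> U" using inv_closed g by auto
  have giX: "(\<lambda>x. matrix_inv g *v x) ` X \<in> sets \<nu>" using image_in_borel[OF gi X] nu_sets by simp
  have giX0: "(\<lambda>x. matrix_inv g *v x) ` X - {0} = (\<lambda>x. matrix_inv g *v x) ` (X - {0})"
  proof -
    have "matrix_inv g *v x = 0 \<longleftrightarrow> x = 0" for x
      by (metis apply_inv_cancel[OF g] matrix_vector_mult_0_right)
    thus ?thesis by auto
  qed
  have scale: "emeasure \<nu> ((\<lambda>x. matrix_inv g *v x) ` (X - {0}))
      = ennreal (opnorm (matrix_inv g) powr (- \<alpha>)) * emeasure \<nu> (X - {0})"
    by (rule scale_invariantD[OF inv gi]) (use X in auto)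
  have "emeasure (distr \<nu> borel ((*v) g)) X = emeasure \<nu> ((\<lambda>x. matrix_inv g *v x) ` X)"
    using emeasure_distr[OF m X] sp vimage_eq_image_inv[OF g] by simp
  also have "\<dots> = emeasure \<nu> ((\<lambda>x. matrix_inv g *v x) ` (X - {0}))"
    unfolding giX0[symmetric] by (rule emeasure_Diff_null_set[OF null giX, symmetric])
  also have "\<dots> = ennreal (opnorm g powr \<alpha>) * emeasure \<nu> X"
  proof -
    have "opnorm (matrix_inv g) powr (- \<alpha>) = opnorm g powr \<alpha>"
      using opnorm_pos[OF g] by (simp add: opnorm_inv[OF g] powr_minus powr_divide)
    moreover have "emeasure \<nu> (X - {0}) = emeasure \<nu> X"
      by (rule emeasure_Diff_null_set[OF null]) (use X nu_sets in simp)
    ultimately show ?thesis using scale by simp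
  qed
  also have "\<dots> = emeasure (density \<nu> (\<lambda>_. ennreal (opnorm g powr \<alpha>))) X"
    by (rule emeasure_density_const[symmetric]) (use X nu_sets in simp)
  finally show "emeasure (distr \<nu> borel ((*v) g)) X
      = emeasure (density \<nu> (\<lambda>_. ennreal (opnorm g powr \<alpha>))) X" .
qed

lemma nn_integral_scale_invariant:
  fixes \<nu> :: "(real^'n) measure"
  assumes nu_sets: "sets \<nu> = sets borel" and nu_zero: "emeasure \<nu> {0} = 0"
    and inv: "scale_invariant U \<alpha> \<nu>" and g: "g \<in> U" and h: "h \<in> borel_measurable borel"
  shows "(\<integral>\<^sup>+y. h (g *v y) \<partial>\<nu>) = ennreal (opnorm g powr \<alpha>) * (\<integral>\<^sup>+y. h y \<partial>\<nu>)"
proof -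
  have mh: "h \<in> borel_measurable \<nu>" using h nu_sets by simp
  have "(\<integral>\<^sup>+y. h (g *v y) \<partial>\<nu>) = (\<integral>\<^sup>+y. h y \<partial>distr \<nu> borel (\<lambda>x. g *v x))"
    by (rule nn_integral_distr[symmetric]) (use nu_sets h in simp_all)
  also have "\<dots> = (\<integral>\<^sup>+y. ennreal (opnorm g powr \<alpha>) * h y \<partial>\<nu>)"
    unfolding distr_scale_invariant[OF nu_sets nu_zero inv g] by (rule nn_integral_density) (simp_all add: mh)
  also have "\<dots> = ennreal (opnorm g powr \<alpha>) * (\<integral>\<^sup>+y. h y \<partial>\<nu>)"
    by (rule nn_integral_cmult) (simp add: mh)
  finally show ?thesis .
qed

end

locale polar_haar = polar_decomposition U AU for U AU :: "(real^'n^'n) set" +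
  fixes H :: "(real^'n^'n) measure"
  assumes H_sigma_finite: "sigma_finite_measure H"
    and AE_H_AU: "AE a in H. a \<in> AU"
    and H_left_invariant: "\<And>a0. a0 \<in> AU \<Longrightarrow> distr H H (\<lambda>a. a0 ** a) = H"
    and measurable_H_left_mult: "\<And>a0. a0 \<in> AU \<Longrightarrow> (\<lambda>a. a0 ** a) \<in> measurable H H"
    and measurable_H_apply:
      "(\<lambda>p. fst p *v snd p) \<in> borel_measurable (H \<Otimes>\<^sub>M (borel :: (real^'n) measure))"
    and measurable_H_opnorm: "opnorm \<in> borel_measurable H"
begin

declare measurable_H_opnorm [measurable]

lemma measurable_apply_compose:
  assumes "g1 \<in> measurable M H" "(g2 :: _ \<Rightarrow> real^'n) \<in> borel_measurable M"
  shows "(\<lambda>z. g1 z *v g2 z) \<in> borel_measurable M"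
  using measurable_compose[OF measurable_Pair[OF assms] measurable_H_apply] by simp

lemma nn_integral_left_translate:
  assumes a0: "a0 \<in> AU" and F: "F \<in> borel_measurable H"
  shows "(\<integral>\<^sup>+a. F (a0 ** a) \<partial>H) = (\<integral>\<^sup>+a. F a \<partial>H)"
  using nn_integral_distr[OF measurable_H_left_mult[OF a0], of F] F H_left_invariant[OF a0] by simp

lemma integral_left_translate:
  fixes F :: "real^'n^'n \<Rightarrow> real"
  assumes a0: "a0 \<in> AU" and F: "F \<in> borel_measurable H"
  shows "(\<integral>a. F (a0 ** a) \<partial>H) = (\<integral>a. F a \<partial>H)"
  using integral_distr[OF measurable_H_left_mult[OF a0], of F] F H_left_invariant[OF a0] by simp

lemma integral_CU_invariant:
  fixes \<rho> :: "(real^'n) measure" and h :: "real^'n \<Rightarrow> real"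
  assumes sr: "sets \<rho> = sets borel" and inv: "CU_invariant U \<rho>" and c: "c \<in> CU U"
    and h: "h \<in> borel_measurable borel"
  shows "(\<integral>x. h (c *v x) \<partial>\<rho>) = (\<integral>x. h x \<partial>\<rho>)"
proof -
  have mr: "measurable \<rho> = measurable borel"
    by (rule ext, rule measurable_cong_sets[OF sr refl])
  have cU: "c \<in> U" using c CU_iff by auto
  have "distr \<rho> borel (\<lambda>x. c *v x) = \<rho>"
  proof (rule measure_eqI)
    show "sets (distr \<rho> borel ((*v) c)) = sets \<rho>" using sr by simp
    fix X assume "X \<in> sets (distr \<rho> borel ((*v) c))"
    hence X: "X \<in> sets borel" by simp
    have sp: "space \<rho> = UNIV" using sets_eq_imp_space_eq[OF sr] by simp
    have "emeasure (distr \<rho> borel ((*v) c)) X = emeasure \<rho> ((\<lambda>x. c *v x) -` X)"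
      using emeasure_distr[of "(*v) c" \<rho> borel X] X sp unfolding mr by simp
    also have "\<dots> = emeasure \<rho> ((\<lambda>x. matrix_inv c *v x) ` X)" using vimage_eq_image_inv[OF cU] by simp
    also have "\<dots> = emeasure \<rho> X" by (rule CU_invariantD[OF inv CU_inv_closed[OF c] X])
    finally show "emeasure (distr \<rho> borel ((*v) c)) X = emeasure \<rho> X" .
  qed
  moreover have "(\<integral>x. h (c *v x) \<partial>\<rho>) = (\<integral>x. h x \<partial>distr \<rho> borel (\<lambda>x. c *v x))"
    using integral_distr[of "(*v) c" \<rho> borel h] h by (simp add: mr)
  ultimately show ?thesis by simp
qed

lemma borel_measurable_polar_inner:
  fixes \<rho> :: "(real^'n) measure"
  assumes sr: "sets \<rho> = sets borel" and fin: "finite_measure \<rho>"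
    and f[measurable]: "f \<in> borel_measurable borel"
  shows "(\<lambda>a. \<integral>x. f (a *v x) * opnorm a powr (- \<alpha>) \<partial>\<rho>) \<in> borel_measurable H"
proof -
  have mHr: "measurable (H \<Otimes>\<^sub>M \<rho>) = measurable (H \<Otimes>\<^sub>M borel)"
    by (rule ext, rule measurable_cong_sets[OF sets_pair_measure_cong[OF refl sr] refl])
  have "(\<lambda>p. fst p *v snd p) \<in> borel_measurable (H \<Otimes>\<^sub>M \<rho>)"
    unfolding mHr by (rule measurable_H_apply)
  hence "(\<lambda>(b, x). f (b *v x) * opnorm b powr (- \<alpha>)) \<in> borel_measurable (H \<Otimes>\<^sub>M \<rho>)"
    by (simp add: case_prod_beta') measurable
  from sigma_finite_measure.borel_measurable_lebesgue_integral[OF _ this] fin show ?thesis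
    unfolding finite_measure_def by simp
qed

lemma polar_integral_apply:
  fixes \<rho> :: "(real^'n) measure" and f :: "real^'n \<Rightarrow> real"
  assumes sr: "sets \<rho> = sets borel" and fin: "finite_measure \<rho>" and inv: "CU_invariant U \<rho>"
    and g: "g \<in> U" and f[measurable]: "f \<in> borel_measurable borel"
  shows "polar_integral \<alpha> H \<rho> (\<lambda>x. f (g *v x)) = opnorm g powr \<alpha> * polar_integral \<alpha> H \<rho> f"
proof -
  obtain a0 c where a0: "a0 \<in> AU" "c \<in> CU U" "g = a0 ** c" "opnorm g = opnorm a0"
    using U_decompE[OF g] by metis
  have a0U: "a0 \<in> U" and cU: "c \<in> U" using a0 AU_in_U CU_iff by auto
  define L where "L b = (\<integral>x. f (b *v x) * opnorm b powr (- \<alpha>) \<partial>\<rho>)" for b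
  have Lm[measurable]: "L \<in> borel_measurable H"
    unfolding L_def by (rule borel_measurable_polar_inner[OF sr fin f])
  have "AE a in H. (\<integral>x. f (g *v (a *v x)) * opnorm a powr (- \<alpha>) \<partial>\<rho>) = opnorm g powr \<alpha> * L (a0 ** a)"
    using AE_H_AU
  proof eventually_elim
    case (elim a)
    have aU: "a \<in> U" using elim AU_in_U by auto
    define ca where "ca = matrix_inv a ** c ** a"
    have ca: "ca \<in> CU U" unfolding ca_def by (rule CU_conj_closed[OF aU a0(2)])
    have "a ** ca = (a ** matrix_inv a) ** (c ** a)" unfolding ca_def by (simp add: matrix_mul_assoc)
    hence "a ** ca = c ** a" by (simp add: mult_inv_right[OF aU] matrix_mul_lid)
    hence move: "g *v (a *v x) = (a0 ** a) *v (ca *v x)" for x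
      unfolding a0(3) by (metis matrix_mul_assoc matrix_vector_mul_assoc)
    have "opnorm a powr (- \<alpha>) = opnorm g powr \<alpha> * opnorm (a0 ** a) powr (- \<alpha>)"
      using opnorm_pos[OF aU] opnorm_pos[OF a0U]
      by (simp add: opnorm_mult[OF a0U aU] a0(4) powr_mult powr_minus field_simps)
    moreover have "(\<integral>x. f ((a0 ** a) *v (ca *v x)) \<partial>\<rho>) = (\<integral>x. f ((a0 ** a) *v x) \<partial>\<rho>)"
      by (rule integral_CU_invariant[OF sr inv ca, of "\<lambda>x. f ((a0 ** a) *v x)"]) measurable
    ultimately show ?case unfolding L_def move by (simp add: ac_simps)
  qed
  hence "polar_integral \<alpha> H \<rho> (\<lambda>x. f (g *v x)) = (\<integral>a. opnorm g powr \<alpha> * L (a0 ** a) \<partial>H)"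
    unfolding polar_integral_def
    by (intro integral_cong_AE borel_measurable_polar_inner[OF sr fin])
      (use measurable_compose[OF measurable_H_left_mult[OF a0(1)] Lm] in measurable)
  also have "\<dots> = opnorm g powr \<alpha> * (\<integral>a. L a \<partial>H)"
    by (simp add: integral_left_translate[OF a0(1) Lm])
  finally show ?thesis unfolding polar_integral_def L_def .
qed

lemma emeasure_image_of_polar_formula:
  fixes \<nu> \<rho> :: "(real^'n) measure"
  assumes nu_sets: "sets \<nu> = sets borel" and sr: "sets \<rho> = sets borel"
    and fin: "finite_measure \<rho>" and inv: "CU_invariant U \<rho>" and formula: "polar_formula \<alpha> H \<rho> \<nu>"
    and g: "g \<in> U" and X: "X \<in> sets borel"
    and finX: "emeasure \<nu> X < \<infinity>" and fingX: "emeasure \<nu> ((\<lambda>x. g *v x) ` X) < \<infinity>"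
  shows "emeasure \<nu> ((\<lambda>x. g *v x) ` X) = ennreal (opnorm g powr (- \<alpha>)) * emeasure \<nu> X"
proof -
  let ?gX = "(\<lambda>x. g *v x) ` X"
  have sp: "space \<nu> = UNIV" using sets_eq_imp_space_eq[OF nu_sets] by simp
  have gX: "?gX \<in> sets borel" by (rule image_in_borel[OF g X])
  have measure_eq: "measure \<nu> Y = polar_integral \<alpha> H \<rho> (indicator Y)"
    if "Y \<in> sets borel" "emeasure \<nu> Y < \<infinity>" for Y
  proof -
    have "integrable \<nu> (indicator Y :: _ \<Rightarrow> real)"
      using that by (simp add: integrable_indicator_iff sp nu_sets)
    moreover have "(\<integral>x. indicator Y x \<partial>\<nu>) = measure \<nu> Y"
      using that nu_sets by (simp add: sp)
    ultimately show ?thesis using polar_formulaD[OF formula] by metis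
  qed
  have "indicator X = (\<lambda>x. indicator ?gX (g *v x) :: real)"
    using inj_image_mem_iff[OF inj_apply[OF g]] by (simp add: fun_eq_iff indicator_def)
  hence "measure \<nu> X = opnorm g powr \<alpha> * measure \<nu> ?gX"
    using measure_eq[OF X finX] measure_eq[OF gX fingX]
      polar_integral_apply[OF sr fin inv g, of "indicator ?gX"] gX by simp
  hence m: "measure \<nu> ?gX = opnorm g powr (- \<alpha>) * measure \<nu> X"
    using opnorm_pos[OF g] by (simp add: powr_minus field_simps)
  have "emeasure \<nu> ?gX = ennreal (opnorm g powr (- \<alpha>) * measure \<nu> X)"
    using fingX by (simp add: emeasure_eq_ennreal_measure m)
  also have "\<dots> = ennreal (opnorm g powr (- \<alpha>)) * emeasure \<nu> X"
    using finX by (simp add: emeasure_eq_ennreal_measure ennreal_mult)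
  finally show ?thesis .
qed

lemma scale_invariant_of_polar_formula:
  fixes \<nu> \<rho> :: "(real^'n) measure"
  assumes L: "levy_measure \<nu>" and sr: "sets \<rho> = sets borel" and fin: "finite_measure \<rho>"
    and inv: "CU_invariant U \<rho>" and formula: "polar_formula \<alpha> H \<rho> \<nu>"
  shows "scale_invariant U \<alpha> \<nu>"
  unfolding scale_invariant_def
proof (intro ballI impI)
  fix g B assume g: "g \<in> U" and B: "B \<in> sets (borel :: (real^'n) measure)" and B0: "0 \<notin> B"
  have nu_sets: "sets \<nu> = sets borel" by (rule levy_measure_sets[OF L])
  define Bk where "Bk k = B \<inter> {y. 1 / real (Suc k) \<le> norm y}" for k
  have Bk: "Bk k \<in> sets borel" for k unfolding Bk_def using B by measurable
  have fin1: "emeasure \<nu> (Bk k) < \<infinity>" for k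
  proof -
    have "emeasure \<nu> (Bk k) \<le> emeasure \<nu> {y. 1 / real (Suc k) \<le> norm y}"
      by (rule emeasure_mono) (auto simp: Bk_def nu_sets)
    also have "\<dots> < \<infinity>" by (rule levy_measure_outside_ball_finite[OF L]) simp
    finally show ?thesis .
  qed
  have fin2: "emeasure \<nu> ((\<lambda>x. g *v x) ` Bk k) < \<infinity>" for k
    by (rule levy_measure_image_outside_ball_finite[OF L g, of "1 / real (Suc k)"]) (auto simp: Bk_def)
  have incB: "incseq Bk" unfolding Bk_def by (rule incseq_annuli)
  have UB: "(\<Union>k. Bk k) = B" unfolding Bk_def by (rule Union_annuli[OF B0])
  have "emeasure \<nu> ((\<lambda>x. g *v x) ` B) = (SUP k. emeasure \<nu> ((\<lambda>x. g *v x) ` Bk k))"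
    unfolding UB[symmetric] image_UN
    by (rule SUP_emeasure_incseq[symmetric])
      (use image_in_borel[OF g Bk] nu_sets incB in \<open>auto simp: incseq_def image_mono\<close>)
  also have "\<dots> = (SUP k. ennreal (opnorm g powr (- \<alpha>)) * emeasure \<nu> (Bk k))"
    using emeasure_image_of_polar_formula[OF nu_sets sr fin inv formula g Bk fin1 fin2] by simp
  also have "\<dots> = ennreal (opnorm g powr (- \<alpha>)) * emeasure \<nu> B"
    unfolding SUP_mult_left_ennreal[symmetric] UB[symmetric]
    by (rule arg_cong[OF SUP_emeasure_incseq]) (use Bk nu_sets incB in auto)
  finally show "emeasure \<nu> ((\<lambda>x. g *v x) ` B) = ennreal (opnorm g powr (- \<alpha>)) * emeasure \<nu> B" .
qed

end

locale polar_kernel = polar_haar U AU H for U AU :: "(real^'n^'n) set" and H +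
  fixes k :: "real \<Rightarrow> ennreal" and \<Psi> :: "real \<Rightarrow> real^'n^'n"
  assumes k_measurable[measurable]: "k \<in> borel_measurable borel"
    and k_normalized: "\<And>z::real^'n. z \<noteq> 0 \<Longrightarrow> (\<integral>\<^sup>+b. k (norm z / opnorm b) \<partial>H) = 1"
    and Psi_measurable[measurable]: "\<Psi> \<in> borel_measurable borel"
    and Psi_AU: "\<And>t. k t \<noteq> 0 \<Longrightarrow> \<Psi> t \<in> AU"
    and Psi_commute: "\<And>c t. c \<in> CU U \<Longrightarrow> \<Psi> t ** c = c ** \<Psi> t"
begin

definition proj :: "real^'n \<Rightarrow> real^'n" where
  "proj y = \<Psi> (norm y) *v y"

lemma proj_measurable[measurable]: "proj \<in> borel_measurable borel"
  unfolding proj_def by (rule borel_measurable_norm_dependent_matrix_apply[OF Psi_measurable])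

end

locale polar_kernel_measure = polar_kernel U AU H k \<Psi>
  for U AU :: "(real^'n^'n) set" and H k \<Psi> +
  fixes \<nu> :: "(real^'n) measure" and \<alpha> :: real
  assumes levy: "levy_measure \<nu>" and invariant: "scale_invariant U \<alpha> \<nu>"
begin

definition D :: "real^'n \<Rightarrow> ennreal" where
  "D y = k (norm y) * ennreal (opnorm (\<Psi> (norm y)) powr (- \<alpha>))"

definition \<rho> :: "(real^'n) measure" where
  "\<rho> = distr (density \<nu> D) borel proj"

abbreviation W :: "real^'n^'n \<Rightarrow> ennreal" where
  "W a \<equiv> ennreal (opnorm a powr (- \<alpha>))"

lemma nu_sets: "sets \<nu> = sets borel"
  by (rule levy_measure_sets[OF levy])

lemma space_nu[simp]: "space \<nu> = UNIV"
  using sets_eq_imp_space_eq[OF nu_sets] by simp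

lemma measurable_nu: "measurable \<nu> = measurable borel"
  by (rule ext, rule measurable_cong_sets[OF nu_sets refl])

lemma measurable_H_nu: "measurable (H \<Otimes>\<^sub>M \<nu>) = measurable (H \<Otimes>\<^sub>M borel)"
  by (rule ext, rule measurable_cong_sets[OF sets_pair_measure_cong[OF refl nu_sets] refl])

lemma pair_sigma_finite_H_nu: "pair_sigma_finite H \<nu>"
  using H_sigma_finite levy_measure_sigma_finite[OF levy] by (simp add: pair_sigma_finite_def)

lemma AE_nu_nonzero: "AE z in \<nu>. z \<noteq> 0"
proof -
  have "{0} \<in> null_sets \<nu>" using levy_measure_zero[OF levy] nu_sets by (auto intro: null_setsI)
  thus ?thesis by (rule AE_I') auto
qed

lemma nn_integral_nu_apply:
  "g \<in> U \<Longrightarrow> h \<in> borel_measurable borel \<Longrightarrow>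
    (\<integral>\<^sup>+y. h (g *v y) \<partial>\<nu>) = ennreal (opnorm g powr \<alpha>) * (\<integral>\<^sup>+y. h y \<partial>\<nu>)"
  by (rule nn_integral_scale_invariant[OF nu_sets levy_measure_zero[OF levy] invariant])

lemma D_measurable[measurable]: "D \<in> borel_measurable borel"
  unfolding D_def by measurable

lemma W_measurable[measurable]: "W \<in> borel_measurable H"
  by measurable

lemma sets_rho[simp]: "sets \<rho> = sets borel"
  unfolding \<rho>_def by simp

lemma nn_integral_rho:
  assumes [measurable]: "g \<in> borel_measurable borel"
  shows "(\<integral>\<^sup>+x. g x \<partial>\<rho>) = (\<integral>\<^sup>+y. D y * g (proj y) \<partial>\<nu>)"
proof -
  have "proj \<in> measurable (density \<nu> D) borel"
    using measurable_cong_sets[of "density \<nu> D" borel borel borel] nu_sets by simp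
  hence "(\<integral>\<^sup>+x. g x \<partial>\<rho>) = (\<integral>\<^sup>+y. g (proj y) \<partial>density \<nu> D)"
    unfolding \<rho>_def by (rule nn_integral_distr) simp
  also have "\<dots> = (\<integral>\<^sup>+y. D y * g (proj y) \<partial>\<nu>)"
    by (rule nn_integral_density) (auto simp: measurable_nu)
  finally show ?thesis .
qed

lemma emeasure_rho:
  "X \<in> sets borel \<Longrightarrow> emeasure \<rho> X = (\<integral>\<^sup>+y. D y * indicator X (proj y) \<partial>\<nu>)"
  using nn_integral_rho[of "indicator X"] by (simp add: nn_integral_indicator)

text \<open>Translating by the inverse of \<open>\<Psi> (norm y)\<close> inside the Haar integral moves \<open>proj y\<close>
  back to \<open>y\<close>; the weight \<open>W\<close> absorbs the factor carried by \<open>D\<close>.\<close>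
lemma nn_integral_H_proj:
  assumes [measurable]: "f \<in> borel_measurable borel"
  shows "(\<integral>\<^sup>+a. D y * (f (a *v proj y) * W a) \<partial>H) = (\<integral>\<^sup>+b. k (norm y) * (f (b *v y) * W b) \<partial>H)"
proof (cases "k (norm y) = 0")
  case True thus ?thesis by (simp add: D_def)
next
  case False
  define a0 where "a0 = \<Psi> (norm y)"
  have a0: "a0 \<in> AU" and a0U: "a0 \<in> U" using Psi_AU[OF False] AU_in_U a0_def by auto
  define ai where "ai = matrix_inv a0"
  have ai: "ai \<in> AU" using AU_inv_closed a0 ai_def by simp
  have [measurable]: "(\<lambda>a. D y * (f (a *v proj y) * W a)) \<in> borel_measurable H"
    using measurable_apply_compose[of "\<lambda>a. a" H "\<lambda>_. proj y"] by measurable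
  have "(\<integral>\<^sup>+a. D y * (f (a *v proj y) * W a) \<partial>H) = (\<integral>\<^sup>+b. D y * (f ((ai ** b) *v proj y) * W (ai ** b)) \<partial>H)"
    by (rule nn_integral_left_translate[OF ai, symmetric]) measurable
  also have "\<dots> = (\<integral>\<^sup>+b. k (norm y) * (f (b *v y) * W b) \<partial>H)"
  proof (rule nn_integral_cong_AE)
    show "AE b in H. D y * (f ((ai ** b) *v proj y) * W (ai ** b)) = k (norm y) * (f (b *v y) * W b)"
      using AE_H_AU
    proof eventually_elim
      case (elim b)
      have bU: "b \<in> U" "ai \<in> U" using elim ai AU_in_U by auto
      have "ai ** b ** a0 = b ** (matrix_inv a0 ** a0)"
        using AU_commute[OF ai elim] ai_def by (simp add: matrix_mul_assoc)
      hence apply_eq: "(ai ** b) *v proj y = b *v y"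
        unfolding proj_def a0_def[symmetric]
        by (simp add: matrix_vector_mul_assoc mult_inv_left[OF a0U] matrix_mul_rid)
      have "opnorm (ai ** b) = opnorm b / opnorm a0"
        using opnorm_mult[OF bU(2) bU(1)] opnorm_inv[OF a0U] ai_def by simp
      moreover have "opnorm a0 powr - \<alpha> * (opnorm b / opnorm a0) powr - \<alpha> = opnorm b powr - \<alpha>"
        using opnorm_pos[OF a0U] opnorm_pos[OF bU(1)] by (simp add: powr_divide powr_minus field_simps)
      ultimately have "opnorm a0 powr - \<alpha> * opnorm (ai ** b) powr - \<alpha> = opnorm b powr - \<alpha>"
        by simp
      hence "ennreal (opnorm a0 powr - \<alpha>) * W (ai ** b) = W b"
        by (simp add: ennreal_mult[symmetric])
      thus ?case unfolding D_def apply_eq a0_def[symmetric] by (metis (no_types, lifting) ac_simps)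
    qed
  qed
  finally show ?thesis .
qed

lemma nn_integral_nu_rescale:
  assumes b: "b \<in> U" and [measurable]: "f \<in> borel_measurable borel"
  shows "(\<integral>\<^sup>+y. k (norm y) * (f (b *v y) * W b) \<partial>\<nu>) = (\<integral>\<^sup>+z. k (norm z / opnorm b) * f z \<partial>\<nu>)"
proof -
  have pb: "opnorm b > 0" using opnorm_pos[OF b] .
  define h where "h z = k (norm z / opnorm b) * (f z * W b)" for z
  have [measurable]: "h \<in> borel_measurable borel" unfolding h_def by measurable
  have "(\<integral>\<^sup>+y. k (norm y) * (f (b *v y) * W b) \<partial>\<nu>) = (\<integral>\<^sup>+y. h (b *v y) \<partial>\<nu>)"
    unfolding h_def using norm_apply[OF b] pb by simp
  also have "\<dots> = (\<integral>\<^sup>+y. ennreal (opnorm b powr \<alpha>) * h y \<partial>\<nu>)"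
    by (simp add: nn_integral_nu_apply[OF b] nn_integral_cmult measurable_nu)
  also have "\<dots> = (\<integral>\<^sup>+z. k (norm z / opnorm b) * f z \<partial>\<nu>)"
  proof (rule nn_integral_cong)
    fix z
    have "ennreal (opnorm b powr \<alpha>) * W b = 1"
      using pb by (simp add: ennreal_mult[symmetric] powr_minus)
    thus "ennreal (opnorm b powr \<alpha>) * h z = k (norm z / opnorm b) * f z"
      unfolding h_def by (metis (no_types, lifting) mult.assoc mult.commute mult.left_neutral)
  qed
  finally show ?thesis .
qed

lemma nn_integral_polar:
  assumes f[measurable]: "f \<in> borel_measurable borel"
  shows "(\<integral>\<^sup>+y. f y \<partial>\<nu>) = (\<integral>\<^sup>+a. (\<integral>\<^sup>+x. f (a *v x) * W a \<partial>\<rho>) \<partial>H)"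
proof -
  have apply_pair: "(\<lambda>z. fst z *v snd z) \<in> borel_measurable (H \<Otimes>\<^sub>M borel)"
   and apply_proj: "(\<lambda>z. fst z *v proj (snd z)) \<in> borel_measurable (H \<Otimes>\<^sub>M borel)"
    by (rule measurable_apply_compose; measurable)+
  have G: "(\<lambda>(a, y). D y * (f (a *v proj y) * W a)) \<in> borel_measurable (H \<Otimes>\<^sub>M \<nu>)"
    and K: "(\<lambda>(b, y). k (norm y) * (f (b *v y) * W b)) \<in> borel_measurable (H \<Otimes>\<^sub>M \<nu>)"
    and L: "(\<lambda>(b, z). k (norm z / opnorm b) * f z) \<in> borel_measurable (H \<Otimes>\<^sub>M \<nu>)"
    unfolding measurable_H_nu case_prod_beta'
    using apply_pair apply_proj by measurable
  have "(\<integral>\<^sup>+a. (\<integral>\<^sup>+x. f (a *v x) * W a \<partial>\<rho>) \<partial>H)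
      = (\<integral>\<^sup>+a. (\<integral>\<^sup>+y. D y * (f (a *v proj y) * W a) \<partial>\<nu>) \<partial>H)"
    by (simp add: nn_integral_rho)
  also have "\<dots> = (\<integral>\<^sup>+y. (\<integral>\<^sup>+a. D y * (f (a *v proj y) * W a) \<partial>H) \<partial>\<nu>)"
    by (rule pair_sigma_finite.Fubini'[OF pair_sigma_finite_H_nu G, symmetric])
  also have "\<dots> = (\<integral>\<^sup>+y. (\<integral>\<^sup>+b. k (norm y) * (f (b *v y) * W b) \<partial>H) \<partial>\<nu>)"
    by (simp add: nn_integral_H_proj)
  also have "\<dots> = (\<integral>\<^sup>+b. (\<integral>\<^sup>+y. k (norm y) * (f (b *v y) * W b) \<partial>\<nu>) \<partial>H)"
    by (rule pair_sigma_finite.Fubini'[OF pair_sigma_finite_H_nu K])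
  also have "\<dots> = (\<integral>\<^sup>+b. (\<integral>\<^sup>+z. k (norm z / opnorm b) * f z \<partial>\<nu>) \<partial>H)"
    by (rule nn_integral_cong_AE) (use AE_H_AU in \<open>auto simp: nn_integral_nu_rescale AU_in_U\<close>)
  also have "\<dots> = (\<integral>\<^sup>+z. (\<integral>\<^sup>+b. k (norm z / opnorm b) * f z \<partial>H) \<partial>\<nu>)"
    by (rule pair_sigma_finite.Fubini'[OF pair_sigma_finite_H_nu L, symmetric])
  also have "\<dots> = (\<integral>\<^sup>+z. f z \<partial>\<nu>)"
  proof (rule nn_integral_cong_AE)
    show "AE z in \<nu>. (\<integral>\<^sup>+b. k (norm z / opnorm b) * f z \<partial>H) = f z"
      using AE_nu_nonzero
    proof eventually_elim
      case (elim z)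
      have "(\<integral>\<^sup>+b. k (norm z / opnorm b) * f z \<partial>H) = (\<integral>\<^sup>+b. k (norm z / opnorm b) \<partial>H) * f z"
        by (rule nn_integral_multc) measurable
      thus ?case using k_normalized[OF elim] by simp
    qed
  qed
  finally show ?thesis by (rule sym)
qed

lemma finite_rho:
  assumes "(\<integral>\<^sup>+y. D y \<partial>\<nu>) < \<infinity>"
  shows "finite_measure \<rho>"
proof (rule finite_measureI)
  show "emeasure \<rho> (space \<rho>) \<noteq> \<infinity>" using emeasure_rho[of UNIV] assms by (simp add: \<rho>_def)
qed

lemma emeasure_rho_outside:
  assumes S: "S \<in> sets borel" and proj_S: "\<And>y. k (norm y) \<noteq> 0 \<Longrightarrow> proj y \<in> S"
  shows "emeasure \<rho> (UNIV - S) = 0"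
proof -
  have "emeasure \<rho> (UNIV - S) = (\<integral>\<^sup>+y. D y * indicator (UNIV - S) (proj y) \<partial>\<nu>)"
    using S by (intro emeasure_rho) auto
  also have "\<dots> = (\<integral>\<^sup>+y. 0 \<partial>\<nu>)"
    by (rule nn_integral_cong) (use proj_S in \<open>auto simp: D_def indicator_def\<close>)
  finally show ?thesis by simp
qed

lemma CU_invariant_rho: "CU_invariant U \<rho>"
  unfolding CU_invariant_def
proof (intro ballI)
  fix c and B :: "(real^'n) set" assume c: "c \<in> CU U" and B: "B \<in> sets borel"
  define ci where "ci = matrix_inv c"
  have ci: "ci \<in> CU U" using CU_inv_closed c ci_def by simp
  have ciU: "ci \<in> U" "opnorm ci = 1" using ci CU_iff by auto
  have cU: "c \<in> U" using c CU_iff by auto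
  define h where "h y = D y * indicator B (proj y)" for y
  have [measurable]: "h \<in> borel_measurable borel" unfolding h_def using B by measurable
  have n: "norm (ci *v y) = norm y" for y using norm_apply[OF ciU(1)] ciU(2) by simp
  have "emeasure \<rho> ((\<lambda>x. c *v x) ` B) = (\<integral>\<^sup>+y. D y * indicator ((\<lambda>x. ci *v x) -` B) (proj y) \<partial>\<nu>)"
    using emeasure_rho[OF image_in_borel[OF cU B]] image_eq_vimage_inv[OF cU] ci_def by simp
  also have "\<dots> = (\<integral>\<^sup>+y. h (ci *v y) \<partial>\<nu>)"
  proof (rule nn_integral_cong)
    fix y
    have "ci *v proj y = proj (ci *v y)"
      unfolding proj_def n by (simp add: matrix_vector_mul_assoc Psi_commute[OF ci])
    thus "D y * indicator ((\<lambda>x. ci *v x) -` B) (proj y) = h (ci *v y)"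
      unfolding h_def D_def n by (simp add: indicator_def)
  qed
  also have "\<dots> = (\<integral>\<^sup>+y. h y \<partial>\<nu>)" using nn_integral_nu_apply[OF ciU(1)] ciU(2) by simp
  also have "\<dots> = emeasure \<rho> B" unfolding h_def using emeasure_rho[OF B] by simp
  finally show "emeasure \<rho> ((\<lambda>x. c *v x) ` B) = emeasure \<rho> B" .
qed

end

context polar_kernel_measure
begin

lemma nu_eq_distr_polar:
  assumes fin: "finite_measure \<rho>"
  shows "\<nu> = distr (density (H \<Otimes>\<^sub>M \<rho>) (\<lambda>z. W (fst z))) borel (\<lambda>z. fst z *v snd z)"
proof (rule measure_eqI)
  have rsf: "sigma_finite_measure \<rho>" using fin unfolding finite_measure_def by simp
  have mHr: "measurable (H \<Otimes>\<^sub>M \<rho>) = measurable (H \<Otimes>\<^sub>M borel)"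
    by (rule ext, rule measurable_cong_sets[OF sets_pair_measure_cong[OF refl sets_rho] refl])
  have Phi[measurable]: "(\<lambda>z. fst z *v snd z) \<in> measurable (H \<Otimes>\<^sub>M \<rho>) borel"
    unfolding mHr by (rule measurable_H_apply)
  have [measurable]: "(\<lambda>z. W (fst z)) \<in> borel_measurable (H \<Otimes>\<^sub>M \<rho>)" by measurable
  show "sets \<nu> = sets (distr (density (H \<Otimes>\<^sub>M \<rho>) (\<lambda>z. W (fst z))) borel (\<lambda>z. fst z *v snd z))"
    by (simp add: nu_sets)
  fix X assume "X \<in> sets \<nu>"
  hence X[measurable]: "X \<in> sets borel" using nu_sets by simp
  have "emeasure \<nu> X = (\<integral>\<^sup>+a. (\<integral>\<^sup>+x. indicator X (a *v x) * W a \<partial>\<rho>) \<partial>H)"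
    using nn_integral_polar[of "indicator X"] X nu_sets by (simp add: nn_integral_indicator)
  also have "\<dots> = (\<integral>\<^sup>+z. indicator X (fst z *v snd z) * W (fst z) \<partial>(H \<Otimes>\<^sub>M \<rho>))"
  proof -
    have "(\<lambda>z. indicator X (fst z *v snd z) * W (fst z)) \<in> borel_measurable (H \<Otimes>\<^sub>M \<rho>)"
      by measurable
    from sigma_finite_measure.nn_integral_fst[OF rsf this] show ?thesis by simp
  qed
  also have "\<dots> = emeasure (distr (density (H \<Otimes>\<^sub>M \<rho>) (\<lambda>z. W (fst z))) borel (\<lambda>z. fst z *v snd z)) X"
  proof -
    have "(\<lambda>z. fst z *v snd z) -` X \<inter> space (H \<Otimes>\<^sub>M \<rho>) \<in> sets (H \<Otimes>\<^sub>M \<rho>)"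
      using measurable_sets[OF Phi X] by simp
    moreover have "(\<lambda>z. fst z *v snd z) \<in> measurable (density (H \<Otimes>\<^sub>M \<rho>) (\<lambda>z. W (fst z))) borel"
      using Phi by (simp add: measurable_cong_sets[of "density _ _" "H \<Otimes>\<^sub>M \<rho>" borel borel])
    ultimately show ?thesis
      by (subst emeasure_distr) (auto simp: emeasure_density intro!: nn_integral_cong simp: indicator_def)
  qed
  finally show "emeasure \<nu> X = emeasure (distr (density (H \<Otimes>\<^sub>M \<rho>) (\<lambda>z. W (fst z))) borel
      (\<lambda>z. fst z *v snd z)) X" .
qed

lemma polar_formula_rho:
  assumes fin: "finite_measure \<rho>"
  shows "polar_formula \<alpha> H \<rho> \<nu>"
  unfolding polar_formula_def
proof (intro allI impI)
  fix f :: "real^'n \<Rightarrow> real" assume f: "integrable \<nu> f"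
  have psf: "pair_sigma_finite H \<rho>"
    using H_sigma_finite fin by (simp add: pair_sigma_finite_def finite_measure_def)
  have mHr: "measurable (H \<Otimes>\<^sub>M \<rho>) = measurable (H \<Otimes>\<^sub>M borel)"
    by (rule ext, rule measurable_cong_sets[OF sets_pair_measure_cong[OF refl sets_rho] refl])
  define V where "V z = opnorm (fst z) powr (- \<alpha>)" for z :: "(real^'n^'n) \<times> (real^'n)"
  define DD where "DD = density (H \<Otimes>\<^sub>M \<rho>) (\<lambda>z. ennreal (V z))"
  have Phi[measurable]: "(\<lambda>z. fst z *v snd z) \<in> measurable (H \<Otimes>\<^sub>M \<rho>) borel"
    unfolding mHr by (rule measurable_H_apply)
  have [measurable]: "V \<in> borel_measurable (H \<Otimes>\<^sub>M \<rho>)"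
    unfolding V_def by measurable
  have PhiD: "(\<lambda>z. fst z *v snd z) \<in> measurable DD borel"
    unfolding DD_def using Phi by (simp add: measurable_cong_sets[of "density _ _" "H \<Otimes>\<^sub>M \<rho>" borel borel])
  have nu: "\<nu> = distr DD borel (\<lambda>z. fst z *v snd z)"
    unfolding DD_def V_def using nu_eq_distr_polar[OF fin] by simp
  have fm[measurable]: "f \<in> borel_measurable borel"
    using f unfolding integrable_iff_bounded by (simp add: measurable_nu)
  have "integrable DD (\<lambda>z. f (fst z *v snd z))"
    using f integrable_distr_eq[OF PhiD fm] nu by simp
  hence int: "integrable (H \<Otimes>\<^sub>M \<rho>) (\<lambda>z. V z *\<^sub>R f (fst z *v snd z))"
    unfolding DD_def by (subst (asm) integrable_density) (auto simp: V_def)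
  have "(\<integral>x. f x \<partial>\<nu>) = (\<integral>z. f (fst z *v snd z) \<partial>DD)"
    using integral_distr[OF PhiD fm] nu by simp
  also have "\<dots> = (\<integral>z. V z *\<^sub>R f (fst z *v snd z) \<partial>(H \<Otimes>\<^sub>M \<rho>))"
    unfolding DD_def by (rule integral_density) (auto simp: V_def)
  also have "\<dots> = (\<integral>a. (\<integral>x. V (a, x) *\<^sub>R f (a *v x) \<partial>\<rho>) \<partial>H)"
    using pair_sigma_finite.integral_fst'[OF psf int] by simp
  finally show "(\<integral>x. f x \<partial>\<nu>) = polar_integral \<alpha> H \<rho> f"
    unfolding V_def polar_integral_def by (simp add: mult.commute)
qed

end

context polar_kernel
begin

theorem scale_invariant_iff_polar_representation:
  fixes \<nu> :: "(real^'n) measure"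
  assumes L: "levy_measure \<nu>" and S: "S \<in> sets borel"
    and proj_S: "\<And>y. k (norm y) \<noteq> 0 \<Longrightarrow> proj y \<in> S"
    and fin: "(\<integral>\<^sup>+y. k (norm y) * ennreal (opnorm (\<Psi> (norm y)) powr (- \<alpha>)) \<partial>\<nu>) < \<infinity>"
  shows "scale_invariant U \<alpha> \<nu> \<longleftrightarrow> polar_representation U \<alpha> S H \<nu>"
proof
  assume inv: "scale_invariant U \<alpha> \<nu>"
  interpret polar_kernel_measure U AU H k \<Psi> \<nu> \<alpha>
    by (intro polar_kernel_measure.intro polar_kernel_axioms polar_kernel_measure_axioms.intro L inv)
  have "finite_measure \<rho>" by (rule finite_rho) (use fin in \<open>simp add: D_def\<close>)
  thus "polar_representation U \<alpha> S H \<nu>"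
    unfolding polar_representation_def
    using emeasure_rho_outside[OF S proj_S] CU_invariant_rho polar_formula_rho sets_rho by blast
next
  assume "polar_representation U \<alpha> S H \<nu>"
  then obtain \<rho> where "sets \<rho> = sets borel" "finite_measure \<rho>" "CU_invariant U \<rho>"
      "polar_formula \<alpha> H \<rho> \<nu>"
    unfolding polar_representation_def by blast
  thus "scale_invariant U \<alpha> \<nu>" by (rule scale_invariant_of_polar_formula[OF L])
qed

end

section \<open>The discrete case\<close>

context polar_decomposition
begin

lemma polar_haar_count_space:
  assumes cAU: "countable AU"
  shows "polar_haar U AU (count_space AU)"
proof (rule polar_haar.intro[OF polar_decomposition_axioms], rule polar_haar_axioms.intro)
  show "sigma_finite_measure (count_space AU)"
    using cAU by (rule sigma_finite_measure_count_space_countable)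
  show "AE a in count_space AU. a \<in> AU" by (simp add: AE_count_space)
  fix a0 assume a0: "a0 \<in> AU"
  have "bij_betw (\<lambda>a. a0 ** a) AU AU"
  proof (rule bij_betwI[where g="\<lambda>a. matrix_inv a0 ** a"])
    show "(\<lambda>a. a0 ** a) \<in> AU \<rightarrow> AU" "(\<lambda>a. matrix_inv a0 ** a) \<in> AU \<rightarrow> AU"
      using AU_mult_closed AU_inv_closed a0 by auto
    fix x
    show "matrix_inv a0 ** (a0 ** x) = x" "a0 ** (matrix_inv a0 ** x) = x"
      by (metis matrix_mul_assoc matrix_mul_lid mult_inv_left mult_inv_right AU_in_U a0)+
  qed
  thus "distr (count_space AU) (count_space AU) (\<lambda>a. a0 ** a) = count_space AU"
    by (rule distr_bij_count_space)
  show "(\<lambda>a. a0 ** a) \<in> count_space AU \<rightarrow>\<^sub>M count_space AU"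
    using AU_mult_closed a0 by (auto simp: measurable_count_space_eq1)
next
  show "(\<lambda>p. fst p *v snd p) \<in> borel_measurable (count_space AU \<Otimes>\<^sub>M (borel :: (real^'n) measure))"
    by (rule measurable_pair_measure_countable1[OF cAU]) simp
  show "opnorm \<in> borel_measurable (count_space AU)" by simp
qed

end

lemma annulus_index_iff:
  fixes r t :: real and n :: int
  assumes r: "0 < r" "r < 1" and t: "t > 0"
  shows "(r \<le> t / r powr n \<and> t / r powr n < 1) \<longleftrightarrow> n = \<lceil>ln t / ln r\<rceil> - 1"
proof -
  define L where "L = ln r"
  have L: "L < 0" unfolding L_def using r by simp
  define x where "x = ln t / L"
  have rp: "r powr n > 0" using r by simp
  have "r \<le> t / r powr n \<longleftrightarrow> ln (r * r powr n) \<le> ln t"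
    using rp r t by (simp add: field_simps)
  also have "ln (r * r powr n) = (n + 1) * L" using r rp unfolding L_def
    by (simp add: ln_mult ln_powr algebra_simps)
  also have "(n + 1) * L \<le> ln t \<longleftrightarrow> x \<le> n + 1" unfolding x_def using L by (simp add: field_simps)
  finally have lower: "r \<le> t / r powr n \<longleftrightarrow> x \<le> n + 1" .
  have "t / r powr n < 1 \<longleftrightarrow> t < r powr n" using rp by (simp add: field_simps)
  also have "\<dots> \<longleftrightarrow> ln t < ln (r powr n)" by (rule ln_less_cancel_iff[symmetric]) (use rp t in auto)
  also have "ln (r powr n) = n * L" using r unfolding L_def by (simp add: ln_powr)
  also have "ln t < n * L \<longleftrightarrow> n < x" unfolding x_def using L by (simp add: field_simps)
  finally have upper: "t / r powr n < 1 \<longleftrightarrow> n < x" .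
  have "(x \<le> n + 1 \<and> n < x) \<longleftrightarrow> n = \<lceil>x\<rceil> - 1"
    by (smt (verit, best) ceiling_correct ceiling_less_iff le_ceiling_iff of_int_1 of_int_add of_int_diff)
  thus ?thesis using lower upper unfolding x_def L_def by simp
qed

context polar_decomposition
begin

text \<open>Every \<open>z \<noteq> 0\<close> lies in exactly one shell \<open>a {x. r \<le> norm x \<and> norm x < 1}\<close>, \<open>a \<in> AU\<close>.\<close>
lemma discrete_kernel_normalized:
  assumes r: "0 < r" "r < 1" and GU: "GU U = range (\<lambda>n::int. r powr of_int n)"
    and z: "(z::real^'n) \<noteq> 0"
  shows "(\<integral>\<^sup>+b. indicator {r..<1} (norm z / opnorm b) \<partial>count_space AU) = 1"
proof -
  define n0 where "n0 = \<lceil>ln (norm z) / ln r\<rceil> - 1"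
  have "r powr of_int n0 \<in> GU U" unfolding GU by simp
  then obtain b0 where b0: "b0 \<in> AU" "opnorm b0 = r powr of_int n0" using GU_AUE by metis
  have "norm z / opnorm b \<in> {r..<1} \<longleftrightarrow> b = b0" if b: "b \<in> AU" for b
  proof -
    obtain n :: int where n: "opnorm b = r powr of_int n" using opnorm_AU_in_GU[OF b] unfolding GU by auto
    have "norm z / opnorm b \<in> {r..<1} \<longleftrightarrow> n = n0"
      unfolding n n0_def using annulus_index_iff[OF r, of "norm z" n] z by simp
    also have "\<dots> \<longleftrightarrow> opnorm b = opnorm b0" using r by (simp add: n b0(2) powr_inj)
    also have "\<dots> \<longleftrightarrow> b = b0" using AU_opnorm_inj[OF b b0(1)] by auto
    finally show ?thesis .
  qed
  hence "(\<integral>\<^sup>+b. indicator {r..<1} (norm z / opnorm b) \<partial>count_space AU)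
      = (\<integral>\<^sup>+b. indicator {b0} b \<partial>count_space AU)"
    by (intro nn_integral_cong) (auto simp: indicator_def)
  also have "\<dots> = 1" using b0 by (simp add: emeasure_count_space_finite)
  finally show ?thesis .
qed

theorem scale_invariant_iff_polar_representation_discrete:
  fixes \<nu> :: "(real^'n) measure"
  assumes L: "levy_measure \<nu>" and r: "0 < r" "r < 1"
    and GU: "GU U = range (\<lambda>n::int. r powr of_int n)" and cAU: "countable AU"
  shows "scale_invariant U \<alpha> \<nu>
    \<longleftrightarrow> polar_representation U \<alpha> {x. r \<le> norm x \<and> norm x < 1} (count_space AU) \<nu>"
proof -
  interpret polar_haar U AU "count_space AU" by (rule polar_haar_count_space[OF cAU])
  interpret polar_kernel U AU "count_space AU" "indicator {r..<1}" "\<lambda>_. mat 1"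
  proof (unfold_locales)
    show "\<And>z::real^'n. z \<noteq> 0 \<Longrightarrow>
        (\<integral>\<^sup>+b. indicator {r..<1} (norm z / opnorm b) \<partial>count_space AU) = 1"
      by (rule discrete_kernel_normalized[OF r GU])
  qed (simp_all add: AU_one matrix_mul_lid matrix_mul_rid)
  show ?thesis
  proof (rule scale_invariant_iff_polar_representation[OF L])
    show "(\<integral>\<^sup>+y. indicator {r..<1} (norm y) * ennreal (opnorm (mat 1 :: real^'n^'n) powr (- \<alpha>)) \<partial>\<nu>)
        < \<infinity>"
    proof -
      have "(\<integral>\<^sup>+y. indicator {r..<1} (norm y) * ennreal (opnorm (mat 1 :: real^'n^'n) powr - \<alpha>) \<partial>\<nu>)
          \<le> (\<integral>\<^sup>+y. indicator {y. r \<le> norm y} y \<partial>\<nu>)"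
        by (rule nn_integral_mono) (auto simp: opnorm_mat_1 indicator_def)
      also have "\<dots> = emeasure \<nu> {y. r \<le> norm y}"
        by (rule nn_integral_indicator) (simp add: levy_measure_sets[OF L])
      also have "\<dots> < \<infinity>" by (rule levy_measure_outside_ball_finite[OF L r(1)])
      finally show ?thesis .
    qed
  qed (auto simp: proj_def indicator_def)
qed

end

section \<open>The continuous case\<close>

lemma bounded_linear_matrix_mult_left: "bounded_linear (\<lambda>X::real^'n^'n. c ** X)"
  and bounded_linear_matrix_mult_right: "bounded_linear (\<lambda>X::real^'n^'n. X ** c)"
proof -
  have "linear (\<lambda>X::real^'n^'n. c ** X)" "linear (\<lambda>X::real^'n^'n. X ** c)"
    by (rule linearI;
        simp add: matrix_matrix_mult_def vec_eq_iff sum_distrib_left algebra_simps sum.distrib)+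
  thus "bounded_linear (\<lambda>X::real^'n^'n. c ** X)" "bounded_linear (\<lambda>X::real^'n^'n. X ** c)"
    by (simp_all add: linear_conv_bounded_linear)
qed

lemma opnorm_matpow_le: "opnorm (matpow (M::real^'n^'n) k) \<le> opnorm M ^ k"
proof (induction k)
  case 0 thus ?case by (simp add: opnorm_mat_1)
next
  case (Suc k)
  have "opnorm (matpow M (Suc k)) \<le> opnorm M * opnorm (matpow M k)"
    by (simp add: opnorm_matrix_mul_le)
  also have "\<dots> \<le> opnorm M * opnorm M ^ k"
    by (rule mult_left_mono[OF Suc]) (simp add: opnorm_def onorm_pos_le matrix_vector_mul_bounded_linear)
  finally show ?case by simp
qed

lemma summable_matexp: "summable (\<lambda>k. (1 / fact k) *\<^sub>R matpow (M::real^'n^'n) k)"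
proof (rule summable_comparison_test)
  let ?C = "real CARD('n) * real CARD('n)"
  show "summable (\<lambda>k. ?C * (inverse (fact k) * opnorm M ^ k))"
    by (rule summable_mult) (rule summable_exp)
  have "norm ((1 / fact k) *\<^sub>R matpow M k) \<le> ?C * (inverse (fact k) * opnorm M ^ k)" for k
  proof -
    have "norm ((1 / fact k) *\<^sub>R matpow M k) \<le> inverse (fact k) * (?C * opnorm (matpow M k))"
      using norm_le_opnorm[of "matpow M k"] by (simp add: field_simps)
    also have "\<dots> \<le> inverse (fact k) * (?C * opnorm M ^ k)"
      by (intro mult_left_mono opnorm_matpow_le) auto
    finally show ?thesis by (simp add: ac_simps)
  qed
  thus "\<exists>N. \<forall>k\<ge>N. norm ((1 / fact k) *\<^sub>R matpow M k) \<le> ?C * (inverse (fact k) * opnorm M ^ k)"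
    by blast
qed

lemma matpow_commute: "c ** M = M ** c \<Longrightarrow> c ** matpow (M::real^'n^'n) k = matpow M k ** c"
  by (induction k) (simp_all add: matrix_mul_lid matrix_mul_rid, metis matrix_mul_assoc)

lemma matexp_commute:
  assumes "c ** M = M ** (c::real^'n^'n)"
  shows "c ** matexp M = matexp M ** c"
proof -
  have "c ** matexp M = (\<Sum>k. c ** ((1 / fact k) *\<^sub>R matpow M k))"
    unfolding matexp_def by (rule bounded_linear.suminf[OF bounded_linear_matrix_mult_left summable_matexp])
  also have "\<dots> = (\<Sum>k. ((1 / fact k) *\<^sub>R matpow M k) ** c)"
    using matpow_commute[OF assms] by (simp add: matrix_scalar_ac scalar_matrix_assoc[symmetric])
  also have "\<dots> = matexp M ** c"
    unfolding matexp_def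
    by (rule bounded_linear.suminf[OF bounded_linear_matrix_mult_right summable_matexp, symmetric])
  finally show ?thesis .
qed

lemma matrpow_commute: "c ** Q = Q ** (c::real^'n^'n) \<Longrightarrow> c ** matrpow t Q = matrpow t Q ** c"
  unfolding matrpow_def
  by (intro matexp_commute) (simp add: matrix_scalar_ac scalar_matrix_assoc[symmetric])

lemma nn_integral_dt_over_t_scale:
  assumes s: "s > 0" and f: "f \<in> borel_measurable borel"
  shows "(\<integral>\<^sup>+t. ennreal (1/t) * f (s * t) * indicator {0<..} t \<partial>lborel)
       = (\<integral>\<^sup>+t. ennreal (1/t) * f t * indicator {0<..} t \<partial>lborel)"
proof -
  define G where "G u = ennreal (1/u) * f u * indicator {0<..} u" for u :: real
  have Gm: "G \<in> borel_measurable borel" unfolding G_def using f by measurable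
  have "(\<integral>\<^sup>+t. G t \<partial>lborel) = ennreal s * (\<integral>\<^sup>+x. G (s * x) \<partial>lborel)"
    using nn_integral_real_affine[OF Gm, of s 0] s by simp
  also have "\<dots> = (\<integral>\<^sup>+x. ennreal s * G (s * x) \<partial>lborel)"
    by (rule nn_integral_cmult[symmetric]) (use Gm in measurable)
  also have "\<dots> = (\<integral>\<^sup>+t. ennreal (1/t) * f (s * t) * indicator {0<..} t \<partial>lborel)"
  proof (rule nn_integral_cong)
    fix x :: real
    show "ennreal s * G (s * x) = ennreal (1/x) * f (s * x) * indicator {0<..} x"
    proof (cases "x > 0")
      case True
      have "ennreal s * ennreal (1 / (s * x)) = ennreal (1/x)"
        using s True by (simp add: ennreal_mult[symmetric])
      thus ?thesis unfolding G_def using True s by (simp add: mult.assoc[symmetric])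
    next
      case False
      thus ?thesis unfolding G_def using s by (simp add: zero_less_mult_iff)
    qed
  qed
  finally show ?thesis unfolding G_def by simp
qed

locale continuous_polar_decomposition = polar_decomposition U AU for U AU :: "(real^'n^'n) set" +
  assumes GU_continuous: "GU U = {0<..}" and AU_closed: "closed AU"
begin

text \<open>The value \<open>mat 1\<close> for \<open>t \<le> 0\<close> is arbitrary: it makes \<open>AU_at\<close> Borel measurable on all
  of \<open>\<real>\<close>, while \<open>haar_cont\<close> only evaluates it on \<open>(0,\<infinity>)\<close>.\<close>
definition AU_at :: "real \<Rightarrow> real^'n^'n" where
  "AU_at t = (if 0 < t then THE a. a \<in> AU \<and> opnorm a = t else mat 1)"

lemma AU_at:
  assumes "t > 0"
  shows "AU_at t \<in> AU" and "opnorm (AU_at t) = t"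
proof -
  obtain a where a: "a \<in> AU" "opnorm a = t" using GU_AUE[of t] GU_continuous assms by auto
  have "\<exists>!a. a \<in> AU \<and> opnorm a = t" using a AU_opnorm_inj by blast
  hence "(THE a. a \<in> AU \<and> opnorm a = t) \<in> AU \<and> opnorm (THE a. a \<in> AU \<and> opnorm a = t) = t"
    by (rule theI')
  thus "AU_at t \<in> AU" "opnorm (AU_at t) = t" using assms unfolding AU_at_def by auto
qed

lemma AU_at_opnorm: "a \<in> AU \<Longrightarrow> AU_at (opnorm a) = a"
  using AU_at[of "opnorm a"] opnorm_pos[OF AU_in_U] AU_opnorm_inj by blast

lemma AU_at_mult:
  assumes a0: "a0 \<in> AU" and t: "t > 0"
  shows "a0 ** AU_at t = AU_at (opnorm a0 * t)"
proof -
  have "opnorm (a0 ** AU_at t) = opnorm a0 * t"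
    using opnorm_mult[OF AU_in_U[OF a0] AU_in_U[OF AU_at(1)[OF t]]] AU_at(2)[OF t] by simp
  thus ?thesis using AU_at_opnorm AU_mult_closed[OF a0 AU_at(1)[OF t]] by metis
qed

lemma compact_AU_opnorm_between:
  assumes "0 < m"
  shows "compact {a \<in> AU. m \<le> opnorm a \<and> opnorm a \<le> M}"
proof -
  have "closed {a::real^'n^'n. m \<le> opnorm a \<and> opnorm a \<le> M}"
    using continuous_on_opnorm
    by (intro closed_Collect_conj closed_Collect_le) (auto intro: continuous_on_const)
  hence "closed (AU \<inter> {a. m \<le> opnorm a \<and> opnorm a \<le> M})" using AU_closed by blast
  moreover have "bounded {a \<in> AU. m \<le> opnorm a \<and> opnorm a \<le> M}"
  proof (rule boundedI)
    fix a assume "a \<in> {a \<in> AU. m \<le> opnorm a \<and> opnorm a \<le> M}"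
    thus "norm a \<le> real CARD('n) * real CARD('n) * M"
      using norm_le_opnorm[of a] by (smt (verit) mult_left_mono of_nat_0_le_iff zero_le_mult_iff mem_Collect_eq)
  qed
  ultimately show ?thesis by (simp add: compact_eq_bounded_closed Int_def)
qed

lemma continuous_on_AU_at_Icc:
  assumes "0 < m"
  shows "continuous_on {m..M} AU_at"
proof -
  let ?K = "{a \<in> AU. m \<le> opnorm a \<and> opnorm a \<le> M}"
  have "opnorm ` ?K = {m..M}"
  proof
    show "{m..M} \<subseteq> opnorm ` ?K"
      using AU_at assms by (intro subsetI, rule_tac x="AU_at x" in image_eqI) auto
  qed auto
  moreover have "continuous_on (opnorm ` ?K) AU_at"
    by (rule continuous_on_inv[OF continuous_on_subset[OF continuous_on_opnorm]
          compact_AU_opnorm_between[OF assms]]) (auto simp: AU_at_opnorm)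
  ultimately show ?thesis by simp
qed

lemma continuous_on_AU_at: "continuous_on {0<..} AU_at"
proof -
  have "isCont AU_at t" if t: "t > 0" for t
    by (rule continuous_on_interior[OF continuous_on_AU_at_Icc[of "t/2" "2*t"]]) (use t in auto)
  thus ?thesis by (simp add: continuous_on_eq_continuous_at)
qed

lemma borel_measurable_AU_at[measurable]: "AU_at \<in> borel_measurable borel"
proof -
  have "AU_at = (\<lambda>t. if t \<in> {0<..} then AU_at t else mat 1)"
    by (auto simp: AU_at_def fun_eq_iff)
  also have "\<dots> \<in> borel_measurable borel"
    by (rule borel_measurable_continuous_on_if) (auto intro: continuous_on_AU_at continuous_on_const)
  finally show ?thesis .
qed

definition haar_line :: "real measure" where
  "haar_line = density (restrict_space lborel {0<..}) (\<lambda>t. ennreal (1/t))"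

lemma haar_cont_eq: "haar_cont AU = distr haar_line borel AU_at"
  unfolding haar_cont_def haar_line_def by (rule distr_cong) (auto simp: AU_at_def)

lemma sets_haar_cont[simp]: "sets (haar_cont AU) = sets borel"
  and space_haar_cont[simp]: "space (haar_cont AU) = UNIV"
  unfolding haar_cont_eq by simp_all

lemma nn_integral_haar_cont:
  assumes F: "F \<in> borel_measurable borel"
  shows "(\<integral>\<^sup>+a. F a \<partial>haar_cont AU) = (\<integral>\<^sup>+t. ennreal (1/t) * F (AU_at t) * indicator {0<..} t \<partial>lborel)"
proof -
  have "AU_at \<in> measurable haar_line borel"
    using measurable_cong_sets[of haar_line "restrict_space borel {0<..}" borel borel]
    unfolding haar_line_def by (simp add: sets_restrict_space_cong[OF sets_lborel] measurable_restrict_space1)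
  hence "(\<integral>\<^sup>+a. F a \<partial>haar_cont AU) = (\<integral>\<^sup>+t. F (AU_at t) \<partial>haar_line)"
    unfolding haar_cont_eq by (rule nn_integral_distr) (use F in simp)
  also have "\<dots> = (\<integral>\<^sup>+t. ennreal (1/t) * F (AU_at t) \<partial>restrict_space lborel {0<..})"
    unfolding haar_line_def
    by (rule nn_integral_density) (use F in \<open>auto simp: measurable_restrict_space1\<close>)
  also have "\<dots> = (\<integral>\<^sup>+t. ennreal (1/t) * F (AU_at t) * indicator {0<..} t \<partial>lborel)"
    by (subst nn_integral_restrict_space) (auto simp: mult.commute)
  finally show ?thesis .
qed

lemma measurable_haar_cont_left_mult: "(\<lambda>a. a0 ** a) \<in> measurable (haar_cont AU) (haar_cont AU)"
  using measurable_cong_sets[OF sets_haar_cont sets_haar_cont] by simp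

lemma haar_cont_left_invariant:
  assumes a0: "a0 \<in> AU"
  shows "distr (haar_cont AU) (haar_cont AU) (\<lambda>a. a0 ** a) = haar_cont AU"
proof (rule measure_eqI)
  show "sets (distr (haar_cont AU) (haar_cont AU) ((**) a0)) = sets (haar_cont AU)" by simp
  fix X assume "X \<in> sets (distr (haar_cont AU) (haar_cont AU) ((**) a0))"
  hence X[measurable]: "X \<in> sets borel" by simp
  have s: "opnorm a0 > 0" using opnorm_pos AU_in_U a0 by auto
  have "emeasure (distr (haar_cont AU) (haar_cont AU) ((**) a0)) X
      = emeasure (haar_cont AU) ((\<lambda>a. a0 ** a) -` X)"
    by (subst emeasure_distr[OF measurable_haar_cont_left_mult]) simp_all
  also have "\<dots> = (\<integral>\<^sup>+a. indicator ((\<lambda>a. a0 ** a) -` X) a \<partial>haar_cont AU)"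
    by (rule nn_integral_indicator[symmetric])
      (simp add: measurable_sets_borel[OF borel_measurable_matrix_mult_left X])
  also have "\<dots> = (\<integral>\<^sup>+a. indicator X (a0 ** a) \<partial>haar_cont AU)"
    by (simp add: indicator_def)
  also have "\<dots> = (\<integral>\<^sup>+t. ennreal (1/t) * indicator X (a0 ** AU_at t) * indicator {0<..} t \<partial>lborel)"
    by (rule nn_integral_haar_cont) measurable
  also have "\<dots> = (\<integral>\<^sup>+t. ennreal (1/t) * indicator X (AU_at (opnorm a0 * t)) * indicator {0<..} t \<partial>lborel)"
    by (rule nn_integral_cong) (use s a0 in \<open>auto simp: AU_at_mult indicator_def\<close>)
  also have "\<dots> = (\<integral>\<^sup>+t. ennreal (1/t) * indicator X (AU_at t) * indicator {0<..} t \<partial>lborel)"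
    by (rule nn_integral_dt_over_t_scale[OF s, where f="\<lambda>u. indicator X (AU_at u)"]) measurable
  also have "\<dots> = emeasure (haar_cont AU) X"
    by (simp add: nn_integral_haar_cont[symmetric])
  finally show "emeasure (distr (haar_cont AU) (haar_cont AU) ((**) a0)) X = emeasure (haar_cont AU) X" .
qed

lemma AE_haar_cont_AU: "AE a in haar_cont AU. a \<in> AU"
proof -
  have "{x \<in> space borel. x \<in> AU} \<in> sets borel" using AU_closed by (simp add: borel_closed)
  moreover have "AU_at \<in> measurable haar_line borel"
    using measurable_cong_sets[of haar_line "restrict_space borel {0<..}" borel borel]
    unfolding haar_line_def by (simp add: sets_restrict_space_cong[OF sets_lborel] measurable_restrict_space1)
  moreover have "AE t in haar_line. AU_at t \<in> AU"
    by (rule AE_I2) (simp add: haar_line_def AU_at)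
  ultimately show ?thesis unfolding haar_cont_eq by (simp add: AE_distr_iff)
qed

lemma emeasure_haar_cont_AU_at_Icc:
  assumes "0 < a"
  shows "emeasure (haar_cont AU) (AU_at ` {a..b}) < \<infinity>"
proof -
  have "closed (AU_at ` {a..b})"
    by (rule compact_imp_closed, rule compact_continuous_image[OF continuous_on_AU_at_Icc[OF assms]]) simp
  hence m[measurable]: "AU_at ` {a..b} \<in> sets borel" by (simp add: borel_closed)
  have "emeasure (haar_cont AU) (AU_at ` {a..b})
      = (\<integral>\<^sup>+t. ennreal (1/t) * indicator (AU_at ` {a..b}) (AU_at t) * indicator {0<..} t \<partial>lborel)"
    using nn_integral_haar_cont[of "indicator (AU_at ` {a..b})"] by simp
  also have "\<dots> \<le> (\<integral>\<^sup>+t. ennreal (1/a) * indicator {a..b} t \<partial>lborel)"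
  proof (rule nn_integral_mono)
    fix t :: real
    show "ennreal (1/t) * indicator (AU_at ` {a..b}) (AU_at t) * indicator {0<..} t
        \<le> ennreal (1/a) * indicator {a..b} t"
    proof (cases "t > 0 \<and> AU_at t \<in> AU_at ` {a..b}")
      case True
      then obtain u where u: "u \<in> {a..b}" "AU_at t = AU_at u" by auto
      have "t = u" using AU_at(2)[of t] AU_at(2)[of u] u True assms by auto
      hence "t \<in> {a..b}" using u by simp
      moreover have "1/t \<le> 1/a" using \<open>t \<in> {a..b}\<close> assms by (simp add: frac_le)
      ultimately show ?thesis using True by (simp add: ennreal_leI)
    qed (auto simp: indicator_def)
  qed
  also have "\<dots> = ennreal (1/a) * emeasure lborel {a..b}"
    by (subst nn_integral_cmult_indicator) auto
  also have "\<dots> < \<infinity>" by (simp add: ennreal_mult_less_top emeasure_lborel_Icc_eq)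
  finally show ?thesis .
qed

lemma AU_subset_Union_AU_at: "AU \<subseteq> (\<Union>k. AU_at ` {1 / real (Suc k) .. real (Suc k)})"
proof
  fix x assume x: "x \<in> AU"
  define t where "t = opnorm x"
  have t: "t > 0" using opnorm_pos AU_in_U x t_def by auto
  obtain k1 where k1: "inverse (real (Suc k1)) < t" using reals_Archimedean t by blast
  obtain k2 where k2: "t < real k2" using reals_Archimedean2 by blast
  define K where "K = max k1 k2"
  have "1 / real (Suc K) \<le> 1 / real (Suc k1)" unfolding K_def by (simp add: frac_le)
  moreover have "real k2 \<le> real K" unfolding K_def by simp
  ultimately have "t \<in> {1 / real (Suc K) .. real (Suc K)}"
    using k1 k2 by (simp add: inverse_eq_divide)
  moreover have "x = AU_at t" using AU_at_opnorm[OF x] t_def by simp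
  ultimately show "x \<in> (\<Union>k. AU_at ` {1 / real (Suc k) .. real (Suc k)})" by blast
qed

lemma sigma_finite_haar_cont: "sigma_finite_measure (haar_cont AU)"
proof -
  define piece where "piece k = AU_at ` {1 / real (Suc k) .. real (Suc k)}" for k :: nat
  define A where "A = insert (UNIV - AU) (range piece)"
  have piece_closed: "closed (piece k)" for k
    unfolding piece_def
    by (rule compact_imp_closed, rule compact_continuous_image[OF continuous_on_AU_at_Icc]) auto
  have AU_compl: "UNIV - AU \<in> sets (haar_cont AU)" using AU_closed by (simp add: borel_open open_Diff)
  show ?thesis
  proof (unfold_locales, intro exI[of _ A] conjI ballI)
    show "countable A" unfolding A_def by simp
    show "A \<subseteq> sets (haar_cont AU)"
      unfolding A_def using piece_closed AU_compl by (simp add: borel_closed image_subset_iff)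
    have "x \<in> \<Union> A" for x
    proof (cases "x \<in> AU")
      case True
      then obtain k where "x \<in> piece k" using AU_subset_Union_AU_at unfolding piece_def by blast
      thus ?thesis unfolding A_def by blast
    qed (simp add: A_def)
    thus "\<Union> A = space (haar_cont AU)" by (simp add: set_eq_iff)
  next
    fix X assume X: "X \<in> A"
    consider "X = UNIV - AU" | k where "X = piece k" using X unfolding A_def by auto
    thus "emeasure (haar_cont AU) X \<noteq> \<infinity>"
    proof cases
      case 1
      have "{x \<in> space (haar_cont AU). \<not> x \<in> AU} = UNIV - AU" by auto
      hence "emeasure (haar_cont AU) (UNIV - AU) = 0"
        using AE_iff_measurable[OF AU_compl] AE_haar_cont_AU by simp
      thus ?thesis using 1 by simp
    next
      case (2 k)
      have "emeasure (haar_cont AU) X < \<infinity>"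
        unfolding 2 piece_def by (rule emeasure_haar_cont_AU_at_Icc) simp
      thus ?thesis by simp
    qed
  qed
qed

lemma polar_haar_cont: "polar_haar U AU (haar_cont AU)"
proof (rule polar_haar.intro[OF polar_decomposition_axioms], rule polar_haar_axioms.intro)
  have "sets (haar_cont AU \<Otimes>\<^sub>M (borel :: (real^'n) measure))
      = sets (borel \<Otimes>\<^sub>M (borel :: (real^'n) measure))"
    by (rule sets_pair_measure_cong) simp_all
  also have "\<dots> = sets borel" by (simp only: borel_prod)
  finally have "measurable (haar_cont AU \<Otimes>\<^sub>M (borel :: (real^'n) measure)) (borel :: (real^'n) measure)
      = measurable borel borel"
    by (rule measurable_cong_sets) simp
  thus "(\<lambda>p. fst p *v snd p) \<in> borel_measurable (haar_cont AU \<Otimes>\<^sub>M (borel :: (real^'n) measure))"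
    by simp
next
  show "opnorm \<in> borel_measurable (haar_cont AU)"
    using measurable_cong_sets[OF sets_haar_cont refl] borel_measurable_opnorm by blast
qed (rule sigma_finite_haar_cont AE_haar_cont_AU haar_cont_left_invariant
      measurable_haar_cont_left_mult | assumption)+

end

context continuous_polar_decomposition
begin

lemma continuous_kernel_normalized:
  assumes z: "(z::real^'n) \<noteq> 0"
  shows "(\<integral>\<^sup>+b. indicator {1..exp 1} (norm z / opnorm b) \<partial>haar_cont AU) = 1"
proof -
  define s where "s = norm z"
  have s: "s > 0" using z s_def by simp
  have to_line: "(\<integral>\<^sup>+b. indicator {1..exp 1} (norm z / opnorm b) \<partial>haar_cont AU)
      = (\<integral>\<^sup>+t. ennreal (1/t) * indicator {1..exp 1} (s / opnorm (AU_at t)) * indicator {0<..} t \<partial>lborel)"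
    unfolding s_def by (rule nn_integral_haar_cont) measurable
  have "ennreal (1/t) * indicator {1..exp 1} (s / opnorm (AU_at t)) * indicator {0<..} t
      = ennreal (1/t) * indicator {s / exp 1 .. s} t" for t :: real
  proof (cases "t > 0")
    case True
    have "(1 \<le> s / t \<and> s / t \<le> exp 1) \<longleftrightarrow> (s / exp 1 \<le> t \<and> t \<le> s)"
      using True by (auto simp: field_simps)
    thus ?thesis using True AU_at(2)[OF True] by (simp add: indicator_def)
  next
    case False
    hence "\<not> s / exp 1 \<le> t" using s by (smt (verit) divide_pos_pos exp_gt_zero)
    thus ?thesis using False by (simp add: indicator_def)
  qed
  hence to_interval: "(\<integral>\<^sup>+t. ennreal (1/t) * indicator {1..exp 1} (s / opnorm (AU_at t)) * indicator {0<..} t \<partial>lborel)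
      = (\<integral>\<^sup>+t\<in>{s / exp 1 .. s}. ennreal (1/t) \<partial>lborel)"
    by (simp add: mult.commute)
  have "(\<integral>\<^sup>+t\<in>{s / exp 1 .. s}. ennreal (1/t) \<partial>lborel) = ennreal (ln s - ln (s / exp 1))"
  proof (rule nn_integral_FTC_Icc)
    fix x :: real assume "x \<in> {s / exp 1..s}"
    hence x: "x > 0" using s by (smt (verit) atLeastAtMost_iff divide_pos_pos exp_gt_zero)
    thus "(ln has_real_derivative 1 / x) (at x)" by (rule DERIV_ln_divide)
    show "0 \<le> 1 / x" using x by simp
  qed (use s in \<open>simp_all add: divide_le_eq\<close>)
  thus ?thesis using to_line to_interval s by (simp add: ln_div)
qed

lemma nn_integral_continuous_weight_finite:
  fixes \<nu> :: "(real^'n) measure"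
  assumes L: "levy_measure \<nu>" and alpha_pos: "\<alpha> > 0"
  shows "(\<integral>\<^sup>+y. indicator {1..exp 1} (norm y) * ennreal (opnorm (AU_at (1 / norm y)) powr - \<alpha>) \<partial>\<nu>)
    < \<infinity>"
proof -
  have "(\<integral>\<^sup>+y. indicator {1..exp 1} (norm y) * ennreal (opnorm (AU_at (1 / norm y)) powr - \<alpha>) \<partial>\<nu>)
      \<le> (\<integral>\<^sup>+y. ennreal (exp 1 powr \<alpha>) * indicator {y. 1 \<le> norm y} y \<partial>\<nu>)"
  proof (rule nn_integral_mono)
    fix y :: "real^'n"
    show "indicator {1..exp 1} (norm y) * ennreal (opnorm (AU_at (1 / norm y)) powr - \<alpha>)
        \<le> ennreal (exp 1 powr \<alpha>) * indicator {y. 1 \<le> norm y} y"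
    proof (cases "1 \<le> norm y \<and> norm y \<le> exp 1")
      case True
      hence p: "norm y > 0" by linarith
      have "opnorm (AU_at (1 / norm y)) powr - \<alpha> = norm y powr \<alpha>"
        using AU_at(2)[of "1 / norm y"] p by (simp add: powr_minus powr_divide)
      also have "\<dots> \<le> exp 1 powr \<alpha>" using True alpha_pos by (intro powr_mono2) auto
      finally show ?thesis using True by (simp add: ennreal_leI)
    qed (auto simp: indicator_def)
  qed
  also have "\<dots> = ennreal (exp 1 powr \<alpha>) * emeasure \<nu> {y. 1 \<le> norm y}"
    by (rule nn_integral_cmult_indicator) (simp add: levy_measure_sets[OF L])
  also have "\<dots> < \<infinity>"
    using levy_measure_outside_ball_finite[OF L, of 1] by (simp add: ennreal_mult_less_top)
  finally show ?thesis .
qed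

theorem scale_invariant_iff_polar_representation_continuous:
  fixes \<nu> :: "(real^'n) measure"
  assumes L: "levy_measure \<nu>" and alpha_pos: "\<alpha> > 0"
    and AU_CU_commute: "\<And>a c. a \<in> AU \<Longrightarrow> c \<in> CU U \<Longrightarrow> a ** c = c ** a"
  shows "scale_invariant U \<alpha> \<nu> \<longleftrightarrow> polar_representation U \<alpha> (sphere 0 1) (haar_cont AU) \<nu>"
proof -
  interpret polar_haar U AU "haar_cont AU" by (rule polar_haar_cont)
  define \<Psi> where "\<Psi> t = AU_at (1/t)" for t :: real
  have Psi_pos: "\<Psi> t \<in> AU" "opnorm (\<Psi> t) = 1/t" if "t > 0" for t
    using AU_at[of "1/t"] that unfolding \<Psi>_def by auto
  interpret polar_kernel U AU "haar_cont AU" "indicator {1..exp 1}" \<Psi>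
  proof (unfold_locales)
    show "\<And>z::real^'n. z \<noteq> 0 \<Longrightarrow> (\<integral>\<^sup>+b. indicator {1..exp 1} (norm z / opnorm b) \<partial>haar_cont AU) = 1"
      by (rule continuous_kernel_normalized)
    show "\<Psi> \<in> borel_measurable borel" unfolding \<Psi>_def by measurable
    show "\<Psi> t \<in> AU" if "indicator {1..exp 1} t \<noteq> (0::ennreal)" for t
      using that Psi_pos(1)[of t] by (auto simp: indicator_def split: if_splits)
    show "\<Psi> t ** c = c ** \<Psi> t" if c: "c \<in> CU U" for c t
    proof (cases "t > 0")
      case True thus ?thesis using AU_CU_commute[OF Psi_pos(1)[OF True] c] by simp
    next
      case False
      hence "\<Psi> t = mat 1" unfolding \<Psi>_def AU_at_def by (auto simp: divide_nonpos_pos)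
      thus ?thesis by (simp add: matrix_mul_lid matrix_mul_rid)
    qed
  qed simp
  show ?thesis
  proof (rule scale_invariant_iff_polar_representation[OF L])
    show "sphere (0::real^'n) 1 \<in> sets borel" by (simp add: borel_closed)
    show "proj y \<in> sphere 0 1" if "indicator {1..exp 1} (norm y) \<noteq> (0::ennreal)" for y :: "real^'n"
    proof -
      have "norm y \<ge> 1" using that by (auto simp: indicator_def split: if_splits)
      hence "norm y > 0" by linarith
      thus ?thesis
        using norm_apply[OF AU_in_U[OF Psi_pos(1)]] Psi_pos(2) by (simp add: proj_def)
    qed
    show "(\<integral>\<^sup>+y. indicator {1..exp 1} (norm y) * ennreal (opnorm (\<Psi> (norm y)) powr - \<alpha>) \<partial>\<nu>)
        < \<infinity>"
      using nn_integral_continuous_weight_finite[OF L alpha_pos] unfolding \<Psi>_def .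
  qed
qed

end

theorem mainTheorem12:
  fixes U AU :: "(real^'n^'n) set"
    and \<alpha> r :: real
    and A Q :: "real^'n^'n"
    and S :: "(real^'n) set"
    and H :: "(real^'n^'n) measure"
    and \<nu> :: "(real^'n) measure"
  assumes U_closed: "closed U"
    and U_subgroup: "matrix_subgroup U"
    and U_sim: "U \<subseteq> similarity_matrices"
    and U_not_orth: "\<not> U \<subseteq> orthogonal_matrices"
    and alpha_pos: "\<alpha> > 0"
    and levy: "levy_measure \<nu>"
    and AU_closed: "closed AU"
    and AU_subgroup: "matrix_subgroup AU"
    and AU_sub: "AU \<subseteq> U"
    and semidirect: "\<forall>u\<in>U. \<exists>a\<in>AU. \<exists>c\<in>CU U. u = a ** c"
    and AU_CU: "AU \<inter> CU U = {mat 1}"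
    and cases_UA:
      "(0 < r \<and> r < 1 \<and> GU U = range (\<lambda>n::int. r powr of_int n)
          \<and> opnorm A = r \<and> AU = range (matpowi A)
          \<and> S = {x. r \<le> norm x \<and> norm x < 1} \<and> H = count_space AU)
       \<or> (GU U = {0<..} \<and> (\<forall>c\<in>CU U. Q ** c = c ** Q)
          \<and> AU = (\<lambda>t. matrpow t Q) ` {0<..}
          \<and> S = sphere 0 1 \<and> H = haar_cont AU)"
  shows "(\<forall>g\<in>U. \<forall>B\<in>sets borel. 0 \<notin> B \<longrightarrow>
             emeasure \<nu> ((\<lambda>x. g *v x) ` B) = ennreal (opnorm g powr (- \<alpha>)) * emeasure \<nu> B)
     \<longleftrightarrow>
     (\<exists>\<rho>. sets \<rho> = sets borel \<and> finite_measure \<rho> \<and> emeasure \<rho> (UNIV - S) = 0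
        \<and> (\<forall>c\<in>CU U. \<forall>B\<in>sets borel. emeasure \<rho> ((\<lambda>x. c *v x) ` B) = emeasure \<rho> B)
        \<and> (\<forall>f::real^'n \<Rightarrow> real. integrable \<nu> f \<longrightarrow>
             (\<integral>x. f x \<partial>\<nu>) = (\<integral>a. (\<integral>x. f (a *v x) * opnorm a powr (- \<alpha>) \<partial>\<rho>) \<partial>H)))"
proof -
  interpret polar_decomposition U AU
    by (intro polar_decomposition.intro similarity_subgroup.intro polar_decomposition_axioms.intro
        U_subgroup U_sim AU_subgroup AU_sub semidirect AU_CU)
  from cases_UA have "scale_invariant U \<alpha> \<nu> \<longleftrightarrow> polar_representation U \<alpha> S H \<nu>"
  proof
    assume discrete: "0 < r \<and> r < 1 \<and> GU U = range (\<lambda>n::int. r powr of_int n)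
        \<and> opnorm A = r \<and> AU = range (matpowi A) \<and> S = {x. r \<le> norm x \<and> norm x < 1} \<and> H = count_space AU"
    hence "countable AU" by simp
    thus ?thesis using scale_invariant_iff_polar_representation_discrete[OF levy] discrete by simp
  next
    assume continuous: "GU U = {0<..} \<and> (\<forall>c\<in>CU U. Q ** c = c ** Q)
        \<and> AU = (\<lambda>t. matrpow t Q) ` {0<..} \<and> S = sphere 0 1 \<and> H = haar_cont AU"
    interpret continuous_polar_decomposition U AU
      by unfold_locales (use continuous AU_closed in auto)
    have "a ** c = c ** a" if "a \<in> AU" "c \<in> CU U" for a c
      using that continuous matrpow_commute[of c Q] by auto
    hence "scale_invariant U \<alpha> \<nu> \<longleftrightarrow> polar_representation U \<alpha> (sphere 0 1) (haar_cont AU) \<nu>"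
      by (rule scale_invariant_iff_polar_representation_continuous[OF levy alpha_pos])
    thus ?thesis using continuous by simp
  qed
  thus ?thesis
    unfolding scale_invariant_def polar_representation_def CU_invariant_def polar_formula_def
      polar_integral_def .
qed

end
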